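(* Let $\mathcal{A}$ and $\mathcal{B}$ be disjoint subsets of $\mathcal{P}^{(1)}$. If $\mathcal{A}$ and $\mathcal{B}$ have Friedberg numberings, and $\mathcal{B}$ is strongly dense in $\mathcal{A}$, then there exists a uniformly c.e. independent sequence $\{\nu_i\}_{i\in\mathbb{N}}$ of Friedberg numberings of $\mathcal{A}\cup\mathcal{B}$.
   Context: $\mathcal{P}^{(1)}$ denotes the set of all partial computable functions from $\mathbb{N}$ to $\mathbb{N}$, and $\langle\cdot,\cdot\rangle$ is a fixed computable bijection from $\mathbb{N}^2$ to $\mathbb{N}$. A numbering of a set $\mathcal{A}$ is a surjective map $\nu\colon\mathbb{N}\to\mathcal{A}$. A numbering $\nu$ is reducible to a numbering $\mu$, written $\nu\leq\mu$, if there is a total computable function $f\colon\mathbb{N}\to\mathbb{N}$ with $\nu=\mu\circ f$. A numbering $\nu$ of a subset of $\mathcal{P}^{(1)}$ is computable if the partial function $(i,x)\mapsto\nu(i)(x)$ from $\mathbb{N}^2$ to $\mathbb{N}$ is partial computable. A Friedberg numbering is an injective computable numbering. A sequence $\{\nu_i\}_{i\in\mathbb{N}}$ of numberings of a subset of $\mathcal{P}^{(1)}$ is uniformly c.e. if the partial function $(i,n,x)\mapsto\nu_i(n)(x)$ from $\mathbb{N}^3$ to $\mathbb{N}$ is partial computable. The direct sum of a sequence $\{\mu_j\}_{j\in\mathbb{N}}$ of numberings of a set $\mathcal{A}$ is the numbering $\bigoplus_{j\in\mathbb{N}}\mu_j$ of $\mathcal{A}$ given by $\bigl(\bigoplus_{j\in\mathbb{N}}\mu_j\bigr)(\langle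 j,k\rangle)=\mu_j(k)$; the notation $\bigoplus_{j\neq i}\nu_j$ means the direct sum of the sequence $\nu_0,\ldots,\nu_{i-1},\nu_{i+1},\nu_{i+2},\ldots$ obtained by omitting $\nu_i$ and reindexing by $\mathbb{N}$ in increasing order. A sequence $\{\nu_i\}_{i\in\mathbb{N}}$ of numberings of a set is independent if $\nu_i\nleq\bigoplus_{j\neq i}\nu_j$ for all $i\in\mathbb{N}$. For $\mathcal{X},\mathcal{Y}\subseteq\mathcal{P}^{(1)}$, $\mathcal{Y}$ is strongly dense in $\mathcal{X}$ if every finite subfunction (restriction to a finite domain) of a member of $\mathcal{X}$ has infinitely many extensions in $\mathcal{Y}$. *)

theory Defs
  imports "HOL-Library.Nat_Bijection"
begin

text \<open>
  Partial computable functions are Kleene's partial recursive functions. Terms carry no arity: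
  evaluating a term on a list of length \<open>n\<close> evaluates each of its subterms only on lists of one
  fixed length, \<open>Zero\<close> is the zero constant of every arity, and an application of another term to a
  list of unsuitable length is undefined, so ill-formed terms add no functions.
\<close>

datatype recf =
    Zero
  | Succ
  | Proj nat
  | Comp recf "recf list"
  | Prec recf recf
  | Mu recf

text \<open>Searching for a zero diverges as soon as it meets an undefined value.\<close>

definition minimize :: "(nat \<rightharpoonup> nat) \<rightharpoonup> nat" where
  "minimize h =
     (if \<exists>y. h y = Some 0 \<and> (\<forall>z<y. \<exists>v>0. h z = Some v)
      then Some (LEAST y. h y = Some 0) else None)"

fun eval :: "recf \<Rightarrow> nat list \<rightharpoonup> nat" where
  "eval Zero xs = Some 0"
| "eval Succ xs = (case xs of [x] \<Rightarrow> Some (Suc x) | _ \<Rightarrow> None)"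
| "eval (Proj i) xs = (if i < length xs then Some (xs ! i) else None)"
| "eval (Comp f gs) xs =
     (let ys = map (\<lambda>g. eval g xs) gs
      in if None \<in> set ys then None else eval f (map the ys))"
| "eval (Prec f g) xs =
     (case xs of
        [] \<Rightarrow> None
      | n # zs \<Rightarrow> rec_nat (eval f zs) (\<lambda>k r. Option.bind r (\<lambda>v. eval g (k # v # zs))) n)"
| "eval (Mu f) xs = minimize (\<lambda>y. eval f (y # xs))"

definition partial_computable1 :: "(nat \<rightharpoonup> nat) \<Rightarrow> bool" where
  "partial_computable1 f \<longleftrightarrow> (\<exists>r. \<forall>x. eval r [x] = f x)"

definition partial_computable2 :: "(nat \<Rightarrow> nat \<rightharpoonup> nat) \<Rightarrow> bool" where
  "partial_computable2 f \<longleftrightarrow> (\<exists>r. \<forall>x y. eval r [x, y] = f x y)"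

definition partial_computable3 :: "(nat \<Rightarrow> nat \<Rightarrow> nat \<rightharpoonup> nat) \<Rightarrow> bool" where
  "partial_computable3 f \<longleftrightarrow> (\<exists>r. \<forall>x y z. eval r [x, y, z] = f x y z)"

definition partial_computable_functions :: "(nat \<rightharpoonup> nat) set" where
  "partial_computable_functions = {f. partial_computable1 f}"

definition total_computable :: "(nat \<Rightarrow> nat) \<Rightarrow> bool" where
  "total_computable f \<longleftrightarrow> partial_computable1 (\<lambda>x. Some (f x))"

definition computable_pairing :: "(nat \<times> nat \<Rightarrow> nat) \<Rightarrow> bool" where
  "computable_pairing p \<longleftrightarrow> bij p \<and> partial_computable2 (\<lambda>x y. Some (p (x, y)))"

definition numbering :: "(nat \<Rightarrow> 'a) \<Rightarrow> 'a set \<Rightarrow> bool" where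
  "numbering \<nu> A \<longleftrightarrow> range \<nu> = A"

definition reducible :: "(nat \<Rightarrow> 'a) \<Rightarrow> (nat \<Rightarrow> 'a) \<Rightarrow> bool" where
  "reducible \<nu> \<mu> \<longleftrightarrow> (\<exists>f. total_computable f \<and> \<nu> = \<mu> \<circ> f)"

definition computable_numbering :: "(nat \<Rightarrow> nat \<rightharpoonup> nat) \<Rightarrow> (nat \<rightharpoonup> nat) set \<Rightarrow> bool" where
  "computable_numbering \<nu> A \<longleftrightarrow> numbering \<nu> A \<and> partial_computable2 \<nu>"

definition friedberg_numbering :: "(nat \<Rightarrow> nat \<rightharpoonup> nat) \<Rightarrow> (nat \<rightharpoonup> nat) set \<Rightarrow> bool" where
  "friedberg_numbering \<nu> A \<longleftrightarrow> computable_numbering \<nu> A \<and> inj \<nu>"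

definition uniformly_ce :: "(nat \<Rightarrow> nat \<Rightarrow> nat \<rightharpoonup> nat) \<Rightarrow> bool" where
  "uniformly_ce \<nu> \<longleftrightarrow> partial_computable3 \<nu>"

definition direct_sum :: "(nat \<times> nat \<Rightarrow> nat) \<Rightarrow> (nat \<Rightarrow> nat \<Rightarrow> 'a) \<Rightarrow> nat \<Rightarrow> 'a" where
  "direct_sum p \<mu> n = (case inv p n of (j, k) \<Rightarrow> \<mu> j k)"

lemma direct_sum_pair: "bij p \<Longrightarrow> direct_sum p \<mu> (p (j, k)) = \<mu> j k"
  by (simp add: direct_sum_def bij_is_inj inv_f_f)

definition omit :: "nat \<Rightarrow> (nat \<Rightarrow> 'a) \<Rightarrow> nat \<Rightarrow> 'a" where
  "omit i s j = (if j < i then s j else s (Suc j))"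

definition independent_sequence ::
    "(nat \<times> nat \<Rightarrow> nat) \<Rightarrow> (nat \<Rightarrow> nat \<Rightarrow> 'a) \<Rightarrow> bool" where
  "independent_sequence p \<nu> \<longleftrightarrow> (\<forall>i. \<not> reducible (\<nu> i) (direct_sum p (omit i \<nu>)))"

definition strongly_dense_in ::
    "(nat \<rightharpoonup> nat) set \<Rightarrow> (nat \<rightharpoonup> nat) set \<Rightarrow> bool" where
  "strongly_dense_in Y X \<longleftrightarrow>
     (\<forall>f\<in>X. \<forall>D. finite D \<longrightarrow> infinite {g \<in> Y. (f |` D) \<subseteq>\<^sub>m g})"

text \<open>The library's pairing function satisfies \<^const>\<open>computable_pairing\<close>.\<close>

lemma computable_pairing_prod_encode: "computable_pairing prod_encode"
proof -
  define plus where "plus = Prec (Proj 0) (Comp Succ [Proj 1])"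
  define tri where "tri = Prec Zero (Comp Succ [Comp plus [Proj 0, Proj 1]])"
  define enc where "enc = Comp plus [Comp tri [Comp plus [Proj 0, Proj 1]], Proj 0]"
  have plus: "eval plus [x, y] = Some (x + y)" for x y
    by (induction x) (simp_all add: plus_def)
  have tri: "eval tri [x] = Some (triangle x)" for x
  proof (induction x)
    case 0
    show ?case by (simp add: tri_def)
  next
    case (Suc x)
    then show ?case by (simp add: tri_def plus)
  qed
  have "eval enc [x, y] = Some (prod_encode (x, y))" for x y
    by (simp add: enc_def plus tri prod_encode_def)
  then show ?thesis
    unfolding computable_pairing_def partial_computable2_def
    using bij_prod_encode by blast
qed

end

theory Submission
  imports Defs
begin

text \<open>
  Fix Friedberg numberings \<open>\<alpha>\<close> of \<open>A\<close> and \<open>\<beta>\<close> of \<open>B\<close>. Each \<open>\<nu> i\<close> lists the functions \<open>\<alpha> e\<close> and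
  \<open>\<beta> b\<close>, every one at exactly one index; it is determined by a bijection \<open>label i\<close> from the indices
  onto the disjoint sum of the indices of \<open>\<alpha>\<close> and of \<open>\<beta>\<close>. As \<open>\<alpha>\<close> and \<open>\<beta>\<close> are
  injective with disjoint ranges, \<open>\<nu> i m = \<nu> j n\<close> holds just when the labels agree, so all arguments
  can be carried out on labels.

  The even index \<open>2 * e\<close> of \<open>\<nu> i\<close> is the diagonal witness against the \<open>e\<close>-th program. It starts
  out enumerating \<open>\<alpha> e\<close>. If the \<open>e\<close>-th program halts on \<open>2 * e\<close>, the index is \<^emph>\<open>redirected\<close>, once,
  to some \<open>\<beta> b\<close> that extends the finite part of \<open>\<alpha> e\<close> enumerated so far. Strong density supplies
  infinitely many such \<open>b\<close>, so \<open>b\<close> can be chosen different from all those used before anywhere in the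
  construction. The odd indices of \<open>\<nu> i\<close> receive what is left: a displaced \<open>\<alpha> e\<close>, or else the
  least \<open>\<beta> b\<close> that \<open>\<nu> i\<close> does not have yet.

  Stages are natural numbers: stage \<open>\<langle>i, m\<rangle>\<close> labels the odd index \<open>2 * m + 1\<close> of \<open>\<nu> i\<close>, and the first
  component of \<open>m\<close> is the witness under attention. Each stage uses exactly one \<open>b\<close>, its \<open>target\<close>, which
  becomes the new label of the witness at a redirection and the label of the odd index otherwise. So
  \<open>label i\<close> is bijective because the targets of the stages belonging to \<open>i\<close> enumerate all \<open>b\<close>
  without repetition (\<open>target_inj\<close>, \<open>target_surj\<close>).

  For independence (\<open>label_not_reducible\<close>) suppose that a reduction sends \<open>n\<close> to index \<open>k\<close> of
  \<open>\<nu> j\<close> with \<open>j \<noteq> i\<close>, and let \<open>e\<close> be a program for \<open>n \<mapsto> \<langle>j, k div 2\<rangle>\<close>. This program halts on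
  \<open>2 * e\<close>, so \<open>2 * e\<close> is redirected in \<open>\<nu> i\<close>, at a stage \<open>s\<close> that exceeds the value
  \<open>\<langle>j, k div 2\<rangle>\<close>, and its label becomes the fresh target of \<open>s\<close>. If \<open>k\<close> is odd, its label was fixed at
  the earlier stage \<open>\<langle>j, k div 2\<rangle>\<close> and differs from the fresh target. If \<open>k\<close> is even, its label is an
  index of \<open>\<alpha>\<close>, or the target of another redirection; the later one of the two redirections has a
  target that avoids the earlier one. So redirections never injure one another, whatever their order.

  Two ingredients make the construction effective. A predicate \<open>computable\<close> on functions between
  encoded types comes with closure rules that let the computability of each defined notion be read off its
  definition. Kleene's normal form (\<open>halts_within_iff_eval\<close>) is obtained from a decidable notion of
  derivation for the evaluation of programs, which yields a decidable, stage-bounded approximation of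
  all partial computable functions at once.
\<close>

section \<open>Computable functions between encoded types\<close>

class encodable =
  fixes encode :: "'a \<Rightarrow> nat"
  assumes inj_encode: "inj encode"

lemma encode_eq_iff [simp]: "encode x = encode y \<longleftrightarrow> x = y"
  by (rule inj_eq[OF inj_encode])

instantiation nat :: encodable
begin
definition encode_nat_def [simp]: "encode (n :: nat) = n"
instance by standard (simp add: inj_on_def)
end

instantiation bool :: encodable
begin
definition encode_bool_def: "encode (b :: bool) = of_bool b"
instance by standard (auto simp: inj_on_def encode_bool_def)
end

instantiation prod :: (encodable, encodable) encodable
begin
definition encode_prod_def: "encode p = prod_encode (encode (fst p), encode (snd p))"
instance by standard (auto simp: inj_on_def encode_prod_def)
end

instantiation list :: (encodable) encodable
begin
definition encode_list_def: "encode xs = list_encode (map encode xs)"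
instance by standard (auto simp: inj_on_def encode_list_def list_encode_eq inj_map_eq_map[OF inj_encode])
end

text \<open>
  Programs are used here with a single argument, the code of the input. Tuples, lists and truth values
  then serve as inputs and outputs alike, no arities have to be tracked, and the closure rules can
  follow the structure of terms.
\<close>

definition computable :: "('a::encodable \<Rightarrow> 'b::encodable) \<Rightarrow> bool" where
  "computable f \<longleftrightarrow> (\<exists>r. \<forall>x. eval r [encode x] = Some (encode (f x)))"

named_theorems computable_intros "closure rules for computable functions"

text \<open>
  For a total search body the unbounded search diverges only by never meeting a zero.
\<close>

lemma minimize_Some:
  "minimize (\<lambda>y. Some (h y)) = (if \<exists>y. h y = 0 then Some (LEAST y. h y = 0) else None)"
proof (cases "\<exists>y. h y = 0")
  case True
  then have "h (LEAST y. h y = 0) = 0" by (rule LeastI_ex)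
  moreover have "\<forall>z<(LEAST y. h y = 0). \<exists>v>0. h z = v"
    using not_less_Least by blast
  ultimately show ?thesis
    unfolding minimize_def using True by auto
next
  case False
  then show ?thesis unfolding minimize_def by auto
qed

lemma computable_id [computable_intros]: "computable (\<lambda>x. x)"
  unfolding computable_def by (rule exI[of _ "Proj 0"]) simp

lemma recf_const: "\<exists>r. \<forall>xs. eval r xs = Some k"
proof (induction k)
  case 0
  show ?case by (rule exI[of _ Zero]) simp
next
  case (Suc k)
  then obtain r where "\<forall>xs. eval r xs = Some k" by blast
  then show ?case by (intro exI[of _ "Comp Succ [r]"]) simp
qed

lemma computable_const [computable_intros]: "computable (\<lambda>x. c)"
  using recf_const unfolding computable_def by blast

lemma computable_comp:
  assumes "computable f" "computable g"
  shows "computable (\<lambda>x. f (g x))"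
proof -
  from assms obtain r q where "\<And>x. eval r [encode x] = Some (encode (f x))"
    and "\<And>x. eval q [encode x] = Some (encode (g x))"
    unfolding computable_def by blast
  then show ?thesis
    unfolding computable_def by (intro exI[of _ "Comp r [q]"]) simp
qed

lemma computable_Pair [computable_intros]:
  assumes "computable f" "computable g"
  shows "computable (\<lambda>x. (f x, g x))"
proof -
  from computable_pairing_prod_encode obtain p where "\<And>x y. eval p [x, y] = Some (prod_encode (x, y))"
    unfolding computable_pairing_def partial_computable2_def by blast
  moreover from assms obtain r q where "\<And>x. eval r [encode x] = Some (encode (f x))"
    and "\<And>x. eval q [encode x] = Some (encode (g x))"
    unfolding computable_def by blast
  ultimately show ?thesis
    unfolding computable_def by (intro exI[of _ "Comp p [r, q]"]) (simp add: encode_prod_def)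
qed

lemma triangle_mono: "m \<le> n \<Longrightarrow> triangle m \<le> triangle n"
  unfolding triangle_def by (intro div_le_mono mult_le_mono) auto

text \<open>
  The code of \<open>(a, b)\<close> lies between the triangular numbers of \<open>a + b\<close> and \<open>a + b + 1\<close>, so the
  diagonal \<open>a + b\<close> is found by a search; this is how \<open>prod_decode\<close> becomes programmable.
\<close>

lemma prod_decode_by_triangle:
  fixes m :: nat
  defines "k \<equiv> LEAST k. Suc m - triangle (Suc k) = 0"
  shows "prod_decode m = (m - triangle k, k - (m - triangle k))"
    and "\<exists>k. Suc m - triangle (Suc k) = 0"
proof -
  obtain a b where m: "m = prod_encode (a, b)"
    by (metis prod_decode_inverse surj_pair)
  have 1: "Suc m - triangle (Suc (a + b)) = 0"
    unfolding m by (simp add: prod_encode_def)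
  \<comment> \<open>Smaller diagonals end before \<open>m\<close>.\<close>
  have 2: "a + b \<le> j" if "Suc m - triangle (Suc j) = 0" for j
  proof (rule ccontr)
    assume "\<not> a + b \<le> j"
    then have "triangle (Suc j) \<le> triangle (a + b)" by (intro triangle_mono) simp
    with that show False unfolding m by (simp add: prod_encode_def)
  qed
  have "k = a + b" unfolding k_def by (rule Least_equality) (use 1 2 in auto)
  then show "prod_decode m = (m - triangle k, k - (m - triangle k))"
    unfolding m prod_encode_inverse by (simp add: prod_encode_def)
  show "\<exists>k. Suc m - triangle (Suc k) = 0" using 1 by blast
qed

lemma recf_prod_decode:
  "\<exists>p. \<forall>m. eval p [m] = Some (fst (prod_decode m))"
  "\<exists>q. \<forall>m. eval q [m] = Some (snd (prod_decode m))"
proof -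
  define plus where "plus = Prec (Proj 0) (Comp Succ [Proj 1])"
  define pred where "pred = Prec Zero (Proj 0)"
  define monus where "monus = Prec (Proj 0) (Comp pred [Proj 1])"
  define sub where "sub = Comp monus [Proj 1, Proj 0]"
  define tri where "tri = Prec Zero (Comp Succ [Comp plus [Proj 0, Proj 1]])"
  define root where "root = Mu (Comp sub [Comp Succ [Proj 1], Comp tri [Comp Succ [Proj 0]]])"
  define p where "p = Comp sub [Proj 0, Comp tri [root]]"
  define q where "q = Comp sub [root, p]"
  have plus: "eval plus [x, y] = Some (x + y)" for x y
    by (induction x) (simp_all add: plus_def)
  have tri: "eval tri [x] = Some (triangle x)" for x
  proof (induction x)
    case 0
    show ?case by (simp add: tri_def)
  next
    case (Suc x)
    then show ?case by (simp add: tri_def plus)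
  qed
  have pred: "eval pred [x] = Some (x - 1)" for x
    by (induction x) (simp_all add: pred_def)
  have monus: "eval monus [y, x] = Some (x - y)" for x y
    by (induction y) (simp_all add: monus_def pred)
  have sub: "eval sub [x, y] = Some (x - y)" for x y
    by (simp add: sub_def monus)
  have root: "eval root [m] = Some (LEAST k. Suc m - triangle (Suc k) = 0)" for m
    using prod_decode_by_triangle(2)[of m] by (simp add: root_def sub tri minimize_Some)
  have p: "eval p [m] = Some (fst (prod_decode m))" for m
    using prod_decode_by_triangle(1)[of m] by (simp add: p_def root sub tri del: triangle_Suc)
  have "eval q [m] = Some (snd (prod_decode m))" for m
    using prod_decode_by_triangle(1)[of m] by (simp add: q_def p root sub tri del: triangle_Suc)
  with p show "\<exists>p. \<forall>m. eval p [m] = Some (fst (prod_decode m))"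
    and "\<exists>q. \<forall>m. eval q [m] = Some (snd (prod_decode m))" by blast+
qed

lemma computable_fst [computable_intros]:
  fixes f :: "'a::encodable \<Rightarrow> 'b::encodable \<times> 'c::encodable"
  assumes "computable f" shows "computable (\<lambda>x. fst (f x))"
proof -
  obtain p where "\<forall>m. eval p [m] = Some (fst (prod_decode m))" using recf_prod_decode(1) by blast
  then have "computable (fst :: 'b \<times> 'c \<Rightarrow> 'b)"
    unfolding computable_def by (intro exI[of _ p]) (simp add: encode_prod_def)
  then show ?thesis by (rule computable_comp[OF _ assms])
qed

lemma computable_snd [computable_intros]:
  fixes f :: "'a::encodable \<Rightarrow> 'b::encodable \<times> 'c::encodable"
  assumes "computable f" shows "computable (\<lambda>x. snd (f x))"
proof -
  obtain q where "\<forall>m. eval q [m] = Some (snd (prod_decode m))" using recf_prod_decode(2) by blast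
  then have "computable (snd :: 'b \<times> 'c \<Rightarrow> 'c)"
    unfolding computable_def by (intro exI[of _ q]) (simp add: encode_prod_def)
  then show ?thesis by (rule computable_comp[OF _ assms])
qed

text \<open>
  Conversions that do not change the code are computed by the identity program.
\<close>

lemma computable_recode:
  assumes "\<And>x. encode (g x) = encode x" "computable f"
  shows "computable (\<lambda>x. g (f x))"
proof -
  have "computable g"
    unfolding computable_def by (intro exI[of _ "Proj 0"]) (simp add: assms(1))
  then show ?thesis by (rule computable_comp[OF _ assms(2)])
qed

lemma computable_encode [computable_intros]:
  "computable f \<Longrightarrow> computable (\<lambda>x. encode (f x))"
  by (rule computable_recode[where g = encode]) simp_all

lemma computable_prod_encode [computable_intros]:
  "computable f \<Longrightarrow> computable (\<lambda>x. prod_encode (f x))"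
  by (rule computable_recode[where g = prod_encode]) (simp_all add: encode_prod_def)

lemma computable_prod_decode [computable_intros]:
  "computable f \<Longrightarrow> computable (\<lambda>x. prod_decode (f x))"
  by (rule computable_recode[where g = prod_decode]) (simp_all add: encode_prod_def)

lemma encode_nat_list [simp]: "encode (xs :: nat list) = list_encode xs"
proof -
  have "map encode xs = xs" by (induction xs) simp_all
  then show ?thesis by (simp add: encode_list_def)
qed

lemma computable_list_encode [computable_intros]:
  "computable f \<Longrightarrow> computable (\<lambda>x. list_encode (f x))"
  by (rule computable_recode[where g = list_encode]) simp_all

lemma computable_list_decode [computable_intros]:
  "computable f \<Longrightarrow> computable (\<lambda>x. list_decode (f x))"
  by (rule computable_recode[where g = list_decode]) simp_all

lemma computable_Suc [computable_intros]:
  assumes "computable f" shows "computable (\<lambda>x. Suc (f x))"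
proof -
  have "computable Suc" unfolding computable_def by (rule exI[of _ Succ]) simp
  then show ?thesis by (rule computable_comp[OF _ assms])
qed

lemma computable_rec_nat [computable_intros]:
  fixes f :: "'a::encodable \<Rightarrow> 'b::encodable"
  assumes "computable f"
    and "computable (\<lambda>p. g (fst p) (fst (snd p)) (snd (snd p)))"
    and "computable n"
  shows "computable (\<lambda>x. rec_nat (f x) (g x) (n x))"
proof -
  from computable_pairing_prod_encode obtain p where p: "\<And>x y. eval p [x, y] = Some (prod_encode (x, y))"
    unfolding computable_pairing_def partial_computable2_def by blast
  from assms obtain rf rg rn where rf: "\<And>x. eval rf [encode x] = Some (encode (f x))"
    and rg': "\<And>p. eval rg [encode p] = Some (encode (g (fst p) (fst (snd p)) (snd (snd p))))"
    and rn: "\<And>x. eval rn [encode x] = Some (encode (n x))"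
    unfolding computable_def by blast
  have rg: "eval rg [prod_encode (encode x, prod_encode (k, encode v))] = Some (encode (g x k v))" for x k v
    using rg'[of "(x, k, v)"] by (simp add: encode_prod_def)
  define r where "r = Prec rf (Comp rg [Comp p [Proj 2, Comp p [Proj 0, Proj 1]]])"
  have r: "eval r [k, encode x] = Some (encode (rec_nat (f x) (g x) k))" for k x
    by (induction k) (simp_all add: r_def rf rg p)
  show ?thesis
    unfolding computable_def by (rule exI[of _ "Comp r [rn, Proj 0]"]) (simp add: rn r)
qed

text \<open>
  These equations turn arithmetic, conditionals and bounded quantifiers into primitive recursions, and
  those for the connectives below give conditionals; the closure rules then follow by rewriting.
\<close>

lemma rec_nat_add: "m + n = rec_nat m (\<lambda>_ r. Suc r) n"
  by (induction n) simp_all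

lemma rec_nat_mult: "m * n = rec_nat 0 (\<lambda>_ r. r + m) n" for m n :: nat
  by (induction n) simp_all

lemma rec_nat_pred: "n - Suc 0 = rec_nat 0 (\<lambda>k _. k) n"
  by (cases n) simp_all

lemma rec_nat_diff: "m - n = rec_nat m (\<lambda>_ r. r - Suc 0) n"
  by (induction n) simp_all

lemma rec_nat_neq_0: "n \<noteq> 0 \<longleftrightarrow> rec_nat False (\<lambda>_ _. True) n"
  by (cases n) simp_all

lemma rec_nat_If: "(if P then a else b) = rec_nat b (\<lambda>_ _. a) (encode P)"
  by (simp add: encode_bool_def)

lemma rec_nat_bounded_ex: "(\<exists>k<n. P k) = rec_nat False (\<lambda>k r. r \<or> P k) n"
  by (induction n) (auto simp: less_Suc_eq)

lemma computable_add [computable_intros]: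
  "computable f \<Longrightarrow> computable g \<Longrightarrow> computable (\<lambda>x. f x + g x :: nat)"
  unfolding rec_nat_add by (intro computable_intros)

lemma computable_mult [computable_intros]:
  assumes "computable f" "computable g" shows "computable (\<lambda>x. f x * g x :: nat)"
  unfolding rec_nat_mult by (intro computable_intros assms computable_comp[OF assms(1)])

lemma computable_diff [computable_intros]:
  assumes "computable f" "computable g" shows "computable (\<lambda>x. f x - g x :: nat)"
  unfolding rec_nat_diff[of "f _"] unfolding rec_nat_pred
  by (intro computable_intros assms)

lemma computable_neq_0:
  "computable f \<Longrightarrow> computable (\<lambda>x. f x \<noteq> (0 :: nat))"
  unfolding rec_nat_neq_0 by (intro computable_intros)

lemma computable_If [computable_intros]:
  assumes "computable P" "computable f" "computable g"
  shows "computable (\<lambda>x. if P x then f x else g x)"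
  unfolding rec_nat_If by (intro computable_intros assms computable_comp[OF assms(2)])

lemma not_If: "(\<not> P) = (if P then False else True)"
  by simp

lemma conj_If: "(P \<and> Q) = (if P then Q else False)"
  by simp

lemma disj_If: "(P \<or> Q) = (if P then True else Q)"
  by simp

lemma imp_If: "(P \<longrightarrow> Q) = (if P then Q else True)"
  by simp

lemma computable_not [computable_intros]:
  "computable P \<Longrightarrow> computable (\<lambda>x. \<not> P x)"
  by (subst not_If) (intro computable_intros)

lemma computable_conj [computable_intros]:
  "computable P \<Longrightarrow> computable Q \<Longrightarrow> computable (\<lambda>x. P x \<and> Q x)"
  by (subst conj_If) (intro computable_intros)

lemma computable_disj [computable_intros]:
  "computable P \<Longrightarrow> computable Q \<Longrightarrow> computable (\<lambda>x. P x \<or> Q x)"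
  by (subst disj_If) (intro computable_intros)

lemma computable_imp [computable_intros]:
  "computable P \<Longrightarrow> computable Q \<Longrightarrow> computable (\<lambda>x. P x \<longrightarrow> Q x)"
  by (subst imp_If) (intro computable_intros)

lemma less_iff_diff: "m < n \<longleftrightarrow> n - m \<noteq> (0 :: nat)"
  by auto

lemma computable_less [computable_intros]:
  "computable f \<Longrightarrow> computable g \<Longrightarrow> computable (\<lambda>x. f x < (g x :: nat))"
  unfolding less_iff_diff[of "f _"] by (intro computable_neq_0 computable_diff)

lemma computable_eq [computable_intros]:
  assumes "computable f" "computable g" shows "computable (\<lambda>x. f x = g x)"
proof -
  have "f x = g x \<longleftrightarrow> \<not> encode (f x) < encode (g x) \<and> \<not> encode (g x) < encode (f x)" for x
    by (metis encode_eq_iff less_irrefl linorder_less_linear)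
  then show ?thesis by (simp only:) (intro computable_intros assms)
qed

lemma computable_bounded_ex [computable_intros]:
  assumes "computable (n :: _ \<Rightarrow> nat)" "computable (\<lambda>p. P (fst p) (snd p))"
  shows "computable (\<lambda>x. \<exists>k<n x. P x k)"
  unfolding rec_nat_bounded_ex
  by (intro computable_intros assms(1) computable_comp[OF assms(2), of "\<lambda>p. (fst p, fst (snd p))", simplified])

lemma computable_bounded_all [computable_intros]:
  assumes "computable (n :: _ \<Rightarrow> nat)" "computable (\<lambda>p. P (fst p) (snd p))"
  shows "computable (\<lambda>x. \<forall>k<n x. P x k)"
proof -
  have "(\<forall>k<n x. P x k) \<longleftrightarrow> \<not> (\<exists>k<n x. \<not> P x k)" for x by blast
  then show ?thesis by (simp only:) (intro computable_intros assms)
qed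

text \<open>
  The only source of partiality: a search for a witness of a decidable relation.
\<close>

lemma recf_search:
  assumes "computable (\<lambda>p. P (fst p) (snd p))"
  shows "\<exists>r. \<forall>x. eval r [encode x] = (if \<exists>y. P x y then Some (LEAST y. P x y) else None)"
proof -
  have "computable (\<lambda>p. if P (snd p) (fst p) then 0 else (1 :: nat))"
    by (intro computable_intros computable_comp[OF assms, of "\<lambda>p. (snd p, fst p)", simplified])
  then obtain r where r: "\<forall>p. eval r [encode p] = Some (encode (if P (snd p) (fst p) then 0 else (1 :: nat)))"
    unfolding computable_def by blast
  from computable_pairing_prod_encode obtain q where "\<And>x y. eval q [x, y] = Some (prod_encode (x, y))"
    unfolding computable_pairing_def partial_computable2_def by blast
  then have "eval (Comp r [q]) [y, encode x] = Some (if P x y then 0 else 1)" for x y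
    using r[rule_format, of "(y, x)"] by (simp add: encode_prod_def)
  then have "eval (Mu (Comp r [q])) [encode x] = (if \<exists>y. P x y then Some (LEAST y. P x y) else None)" for x
    using minimize_Some[of "\<lambda>y. if P x y then 0 else 1"] by (simp del: eval.simps(4))
  then show ?thesis by blast
qed

lemma computable_Least:
  assumes "computable (\<lambda>p. P (fst p) (snd p))" "\<And>x. \<exists>y :: nat. P x y"
  shows "computable (\<lambda>x. LEAST y. P x y)"
  using recf_search[OF assms(1)] assms(2) unfolding computable_def by simp

lemma computable_by_code: "computable (\<lambda>x. encode (f x)) \<Longrightarrow> computable f"
  unfolding computable_def by simp

lemma encode_Nil: "encode [] = 0"
  by (simp add: encode_list_def)

lemma encode_Cons: "encode (x # xs) = Suc (prod_encode (encode x, encode xs))"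
  by (simp add: encode_list_def)

lemma computable_Cons [computable_intros]:
  assumes "computable f" "computable g" shows "computable (\<lambda>x. f x # g x)"
  by (rule computable_by_code) (simp only: encode_Cons, intro computable_intros assms)

lemma encode_tl: "encode (tl xs) = snd (prod_decode (encode xs - Suc 0))"
proof (cases xs)
  case Nil
  have "prod_decode 0 = (0, 0)" by (simp add: prod_decode_def prod_decode_aux.simps[of 0 0])
  with Nil show ?thesis by (simp add: encode_Nil)
qed (simp add: encode_Cons)

lemma computable_tl [computable_intros]:
  assumes "computable f" shows "computable (\<lambda>x. tl (f x))"
  by (rule computable_by_code) (simp only: encode_tl, intro computable_intros assms)

text \<open>
  The value of \<open>hd []\<close> is unspecified but fixed, so the case distinction only adds a constant.
\<close>

lemma encode_hd:
  "encode (hd xs) = (if xs = [] then encode (hd [] :: 'a) else fst (prod_decode (encode xs - Suc 0)))"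
  for xs :: "'a::encodable list"
  by (cases xs) (simp_all add: encode_Cons)

lemma computable_hd [computable_intros]:
  assumes "computable f" shows "computable (\<lambda>x. hd (f x))"
  by (rule computable_by_code) (subst encode_hd, intro computable_intros assms)

lemma rec_nat_drop: "drop n xs = rec_nat xs (\<lambda>_. tl) n"
proof (induction n)
  case (Suc n)
  have "drop (Suc n) xs = tl (drop n xs)" by (simp add: drop_Suc tl_drop)
  with Suc show ?case by simp
qed simp

lemma computable_drop [computable_intros]:
  assumes "computable n" "computable f" shows "computable (\<lambda>x. drop (n x) (f x))"
  unfolding rec_nat_drop by (intro computable_intros assms)

lemma length_eq_Least: "length xs = (LEAST n. drop n xs = [])"
  by (rule Least_equality[symmetric]) auto

lemma computable_length [computable_intros]:
  assumes "computable f" shows "computable (\<lambda>x. length (f x))"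
  unfolding length_eq_Least
  by (rule computable_Least) (intro computable_intros computable_comp[OF assms], auto)

lemma bex_set_iff_drop: "(\<exists>d\<in>set xs. P d) \<longleftrightarrow> (\<exists>k<length xs. P (hd (drop k xs)))"
  by (metis hd_drop_conv_nth in_set_conv_nth)

lemma computable_bex_set [computable_intros]:
  assumes "computable f" "computable (\<lambda>p. P (fst p) (snd p))"
  shows "computable (\<lambda>x. \<exists>d\<in>set (f x). P x d)"
  unfolding bex_set_iff_drop
  by (intro computable_intros assms(1) computable_comp[OF assms(1)]
      computable_comp[OF assms(2), of "\<lambda>p. (fst p, hd (drop (snd p) (f (fst p))))", simplified])

lemma computable_mem_set [computable_intros]:
  assumes "computable f" "computable g"
  shows "computable (\<lambda>x. g x \<in> set (f x))"
proof -
  have "g x \<in> set (f x) \<longleftrightarrow> (\<exists>d\<in>set (f x). d = g x)" for x by blast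
  then show ?thesis by (simp only:) (intro computable_intros assms computable_comp[OF assms(2)])
qed

lemma computable_div2 [computable_intros]:
  assumes "computable f" shows "computable (\<lambda>x. f x div 2 :: nat)"
proof -
  have "n div 2 = (LEAST q. n < Suc (Suc (2 * q)))" for n :: nat
    by (rule Least_equality[symmetric]) auto
  then show ?thesis
    by (simp only:) (rule computable_Least, intro computable_intros computable_comp[OF assms], presburger)
qed

section \<open>Kleene normal form through derivations\<close>

fun recf_code :: "recf \<Rightarrow> nat" where
  "recf_code Zero = prod_encode (0, 0)"
| "recf_code Succ = prod_encode (1, 0)"
| "recf_code (Proj i) = prod_encode (2, i)"
| "recf_code (Comp f gs) = prod_encode (3, prod_encode (recf_code f, list_encode (map recf_code gs)))"
| "recf_code (Prec f g) = prod_encode (4, prod_encode (recf_code f, recf_code g))"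
| "recf_code (Mu f) = prod_encode (5, recf_code f)"

text \<open>
  Two auxiliary judgements besides evaluation get codes of their own: evaluating a list of programs on
  the same arguments (the value being the code of the list of results), and the search of \<open>Mu\<close> started
  at the first argument.
\<close>

abbreviation args_code :: "recf list \<Rightarrow> nat" where
  "args_code gs \<equiv> prod_encode (6, list_encode (map recf_code gs))"

abbreviation search_code :: "recf \<Rightarrow> nat" where
  "search_code f \<equiv> prod_encode (7, recf_code f)"

type_synonym claim = "nat \<times> nat list \<times> nat"

text \<open>
  A claim \<open>(c, xs, v)\<close> says that the program coded by \<open>c\<close> has value \<open>v\<close> on \<open>xs\<close>. It is justified by
  claims in \<open>D\<close> if it follows from some of them by one evaluation rule; the intermediate value needed in
  such a rule is read off a claim in \<open>D\<close>, which keeps the check decidable. The number \<open>k\<close> is the tag of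
  the code, with \<open>6\<close> and \<open>7\<close> for the auxiliary judgements.
\<close>

definition justified :: "claim list \<Rightarrow> claim \<Rightarrow> bool" where
  "justified D = (\<lambda>(c, xs, v).
     let k = fst (prod_decode c); q = snd (prod_decode c);
         q1 = fst (prod_decode q); q2 = snd (prod_decode q)
     in if k = 0 then v = 0
        else if k = 1 then xs \<noteq> [] \<and> tl xs = [] \<and> v = Suc (hd xs)
        else if k = 2 then q < length xs \<and> v = hd (drop q xs)
        else if k = 3 then
          (\<exists>d\<in>set D. fst d = prod_encode (6, q2) \<and> fst (snd d) = xs \<and>
            (q1, list_decode (snd (snd d)), v) \<in> set D)
        else if k = 4 then
          xs \<noteq> [] \<and>
          (if hd xs = 0 then (q1, tl xs, v) \<in> set D
           else \<exists>d\<in>set D. fst d = c \<and> fst (snd d) = (hd xs - 1) # tl xs \<and>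
             (q2, (hd xs - 1) # snd (snd d) # tl xs, v) \<in> set D)
        else if k = 5 then (prod_encode (7, q), 0 # xs, v) \<in> set D
        else if k = 6 then
          (if q = 0 then v = 0
           else v \<noteq> 0 \<and> (hd (list_decode q), xs, hd (list_decode v)) \<in> set D \<and>
             (prod_encode (6, list_encode (tl (list_decode q))), xs, list_encode (tl (list_decode v))) \<in> set D)
        else
          xs \<noteq> [] \<and>
          (((q, xs, 0) \<in> set D \<and> v = hd xs) \<or>
           (\<exists>d\<in>set D. fst d = q \<and> fst (snd d) = xs \<and> snd (snd d) \<noteq> 0 \<and>
             (c, Suc (hd xs) # tl xs, v) \<in> set D)))"

lemma computable_justified [computable_intros]:
  assumes "computable D" "computable z"
  shows "computable (\<lambda>x. justified (D x) (z x))"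
  unfolding justified_def Let_def case_prod_unfold
  by (intro computable_intros assms computable_comp[OF assms(1)] computable_comp[OF assms(2)])

text \<open>
  Each claim must be justified by those behind it in the list, so that derivations grow by \<open>(#)\<close>.
\<close>

definition derivation :: "claim list \<Rightarrow> bool" where
  "derivation D \<longleftrightarrow> (\<forall>k<length D. justified (drop (Suc k) D) (hd (drop k D)))"

lemma computable_derivation [computable_intros]:
  assumes "computable D"
  shows "computable (\<lambda>x. derivation (D x))"
  unfolding derivation_def
  by (intro computable_intros assms computable_comp[OF assms(1)])

lemma derivation_Nil: "derivation []"
  by (simp add: derivation_def)

lemma derivation_Cons: "derivation (z # D) \<longleftrightarrow> justified D z \<and> derivation D"
  by (simp add: derivation_def All_less_Suc2)

lemma justified_mono:
  assumes "justified D z" "set D \<subseteq> set E"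
  shows "justified E z"
proof -
  have if_mono: "(P \<Longrightarrow> A \<longrightarrow> A') \<Longrightarrow> (\<not> P \<Longrightarrow> B \<longrightarrow> B') \<Longrightarrow>
      (if P then A else B) \<longrightarrow> (if P then A' else B')" for P A A' B B' by simp
  have conj_mono: "(A \<longrightarrow> A') \<Longrightarrow> P \<and> A \<longrightarrow> P \<and> A'" for P A A' by simp
  obtain c xs v where z: "z = (c, xs, v)" by (cases z)
  have "justified D z \<longrightarrow> justified E z"
    unfolding z justified_def Let_def prod.case
    by (intro if_mono conj_mono) (use assms(2) in blast)+
  with assms(1) show ?thesis by blast
qed

lemma Least_root:
  assumes "h y = Some (0 :: nat)" "\<forall>z<y. \<exists>v>0. h z = Some v"
  shows "(LEAST y. h y = Some 0) = (y :: nat)"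
proof (rule Least_equality)
  show "y \<le> z" if "h z = Some 0" for z
    using that assms(2) by (metis leI less_irrefl option.inject)
qed fact

lemma list_encode_Cons_neq_0: "list_encode (x # xs) \<noteq> 0" "0 < list_encode (x # xs)"
  by simp_all

lemma derivation_append: "derivation D \<Longrightarrow> derivation E \<Longrightarrow> derivation (D @ E)"
proof (induction D)
  case (Cons z D)
  then show ?case
    using justified_mono[of D z "D @ E"] by (simp add: derivation_Cons)
qed simp

definition derivable :: "nat \<Rightarrow> nat list \<Rightarrow> nat \<Rightarrow> bool" where
  "derivable c xs v \<longleftrightarrow> (\<exists>D. derivation D \<and> (c, xs, v) \<in> set D)"

lemma derivableI:
  assumes "justified P (c, xs, v)" "\<And>c' xs' v'. (c', xs', v') \<in> set P \<Longrightarrow> derivable c' xs' v'"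
  shows "derivable c xs v"
proof -
  have "\<exists>D. derivation D \<and> set P \<subseteq> set D"
    using assms(2)
  proof (induction P)
    case Nil
    then show ?case using derivation_Nil by auto
  next
    case (Cons z P)
    obtain D where D: "derivation D" "set P \<subseteq> set D"
      using Cons.IH[OF Cons.prems[OF list.set_intros(2)]] by blast
    obtain a b c where z: "z = (a, b, c)" by (cases z)
    then obtain E where "derivation E" "z \<in> set E"
      using Cons.prems[of a b c] unfolding derivable_def by auto
    with D show ?case by (intro exI[of _ "E @ D"]) (auto intro: derivation_append)
  qed
  then obtain D where "derivation D" "set P \<subseteq> set D" by blast
  then have "derivation ((c, xs, v) # D)"
    using justified_mono[OF assms(1)] by (simp add: derivation_Cons)
  then show ?thesis unfolding derivable_def by (intro exI[of _ "(c, xs, v) # D"]) simp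
qed

text \<open>
  The search from \<open>k\<close> is derived from the search from \<open>Suc k\<close>, hence the downward induction starting at
  the zero \<open>y\<close>.
\<close>

lemma derivable_search:
  assumes "\<And>y v. eval f (y # xs) = Some v \<Longrightarrow> derivable (recf_code f) (y # xs) v"
    and "eval f (y # xs) = Some 0" "\<And>z. z < y \<Longrightarrow> \<exists>v>0. eval f (z # xs) = Some v"
    and "k \<le> y"
  shows "derivable (search_code f) (k # xs) y"
  using assms(4)
proof (induction k rule: inc_induct)
  case base
  from assms(1)[OF assms(2)] show ?case
    by - (rule derivableI[of "[(recf_code f, y # xs, 0)]"], auto simp: justified_def Let_def)
next
  case (step n)
  from step(2) obtain v where v: "v > 0" "eval f (n # xs) = Some v" using assms(3) by blast
  from assms(1)[OF v(2)] v(1) step.IH show ?case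
    by - (rule derivableI[of "[(recf_code f, n # xs, v), (search_code f, Suc n # xs, y)]"],
      auto simp: justified_def Let_def)
qed

lemma derivable_args:
  assumes "list_all2 (\<lambda>g y. derivable (recf_code g) xs y) gs ys"
  shows "derivable (args_code gs) xs (list_encode ys)"
  using assms
proof (induction rule: list_all2_induct)
  case Nil
  show ?case by (rule derivableI[of "[]"]) (simp_all add: justified_def Let_def)
next
  case (Cons g gs y ys)
  show ?case
    by (rule derivableI[of "[(recf_code g, xs, y), (args_code gs, xs, list_encode ys)]"])
      (use Cons in \<open>auto simp: justified_def Let_def list_encode_Cons_neq_0 simp del: list_encode.simps(2)\<close>)
qed

lemma derivable_complete:
  "eval r xs = Some v \<Longrightarrow> derivable (recf_code r) xs v"
proof (induction r xs arbitrary: v rule: eval.induct)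
  case (1 xs)
  then show ?case by - (rule derivableI[of "[]"], simp_all add: justified_def Let_def)
next
  case (2 xs)
  then show ?case by - (rule derivableI[of "[]"], auto simp: justified_def Let_def split: list.splits)
next
  case (3 i xs)
  then show ?case by - (rule derivableI[of "[]"], auto simp: justified_def Let_def hd_drop_conv_nth split: if_splits)
next
  case (4 f gs xs)
  let ?ys = "map (\<lambda>g. eval g xs) gs"
  have "None \<notin> set ?ys" and f: "eval f (map the ?ys) = Some v"
    using 4(3) by (auto simp: Let_def split: if_splits)
  have "derivable (recf_code g) xs (the (eval g xs))" if "g \<in> set gs" for g
  proof -
    from \<open>None \<notin> set ?ys\<close> that have "eval g xs \<noteq> None" by (metis image_eqI set_map)
    then have "eval g xs = Some (the (eval g xs))" by simp
    then show ?thesis by (rule 4(1)[OF that])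
  qed
  then have "list_all2 (\<lambda>g y. derivable (recf_code g) xs y) gs (map the ?ys)"
    by (simp add: list_all2_map2 list_all2_same)
  from derivable_args[OF this] have "derivable (args_code gs) xs (list_encode (map the ?ys))" .
  moreover have "derivable (recf_code f) (map the ?ys) v"
    using 4(2) f \<open>None \<notin> set ?ys\<close> by simp
  ultimately show ?case
    by - (rule derivableI[of "[(args_code gs, xs, list_encode (map the ?ys)), (recf_code f, map the ?ys, v)]"],
      auto simp: justified_def Let_def)
next
  case (5 f g xs)
  from 5(3) obtain n zs where xs: "xs = n # zs" by (auto split: list.splits)
  have "derivable (recf_code (Prec f g)) (k # zs) w" if "eval (Prec f g) (k # zs) = Some w" for k w
    using that
  proof (induction k arbitrary: w)
    case 0
    then have "derivable (recf_code f) zs w" using 5(1)[OF xs] by simp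
    then show ?case
      by - (rule derivableI[of "[(recf_code f, zs, w)]"], auto simp: justified_def Let_def)
  next
    case (Suc k)
    from Suc.prems obtain u where u: "eval (Prec f g) (k # zs) = Some u" "eval g (k # u # zs) = Some w"
      by (auto simp: bind_eq_Some_conv)
    with Suc.IH have "derivable (recf_code (Prec f g)) (k # zs) u" by blast
    moreover have "derivable (recf_code g) (k # u # zs) w" using 5(2)[OF xs] u by simp
    ultimately show ?case
      by - (rule derivableI[of "[(recf_code (Prec f g), k # zs, u), (recf_code g, k # u # zs, w)]"],
        auto simp: justified_def Let_def)
  qed
  with 5(3) show ?case unfolding xs by blast
next
  case (6 f xs)
  from 6(2) have *: "\<exists>y. eval f (y # xs) = Some 0 \<and> (\<forall>z<y. \<exists>v>0. eval f (z # xs) = Some v)"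
    and v: "v = (LEAST y. eval f (y # xs) = Some 0)"
    by (auto simp: minimize_def split: if_splits)
  then obtain y where y: "eval f (y # xs) = Some 0" "\<forall>z<y. \<exists>v>0. eval f (z # xs) = Some v" by blast
  then have "v = y" unfolding v by (rule Least_root)
  then have "derivable (search_code f) (0 # xs) v"
    using y 6(1) by (intro derivable_search) auto
  then show ?case
    by - (rule derivableI[of "[(search_code f, 0 # xs, v)]"], auto simp: justified_def Let_def)
qed

text \<open>
  The invariant behind soundness. Numbers that code no program carry no obligation.
\<close>

definition sound_claim :: "nat \<Rightarrow> nat list \<Rightarrow> nat \<Rightarrow> bool" where
  "sound_claim c xs v \<longleftrightarrow>
     (\<forall>r. c = recf_code r \<longrightarrow> eval r xs = Some v) \<and>
     (\<forall>gs. c = args_code gs \<longrightarrow> map (\<lambda>g. eval g xs) gs = map Some (list_decode v)) \<and>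
     (\<forall>f. c = search_code f \<longrightarrow> eval f (v # tl xs) = Some 0 \<and>
       (\<forall>z. hd xs \<le> z \<and> z < v \<longrightarrow> (\<exists>w>0. eval f (z # tl xs) = Some w)))"

lemma justified_sound_recf:
  assumes "justified D (recf_code r, xs, v)"
    and sound: "\<And>c' xs' v'. (c', xs', v') \<in> set D \<Longrightarrow> sound_claim c' xs' v'"
  shows "eval r xs = Some v"
proof (cases r)
  case Zero
  then show ?thesis using assms(1) by (simp add: justified_def Let_def)
next
  case Succ
  then show ?thesis using assms(1) by (cases xs) (auto simp: justified_def Let_def neq_Nil_conv split: list.splits)
next
  case (Proj i)
  then show ?thesis using assms(1) by (auto simp: justified_def Let_def hd_drop_conv_nth)
next
  case (Comp f gs)
  with assms(1) obtain w where "(args_code gs, xs, w) \<in> set D" "(recf_code f, list_decode w, v) \<in> set D"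
    by (auto simp: justified_def Let_def)
  then have m: "map (\<lambda>g. eval g xs) gs = map Some (list_decode w)" and f: "eval f (list_decode w) = Some v"
    using sound unfolding sound_claim_def by blast+
  have "map the (map Some (list_decode w)) = list_decode w" by (induction "list_decode w") simp_all
  then show ?thesis unfolding Comp eval.simps m Let_def using f by auto
next
  case (Prec f g)
  with assms(1) obtain n zs where xs: "xs = n # zs" by (cases xs) (auto simp: justified_def Let_def)
  show ?thesis
  proof (cases n)
    case 0
    then have "(recf_code f, zs, v) \<in> set D" using assms(1) Prec xs by (simp add: justified_def Let_def)
    then have "eval f zs = Some v" using sound unfolding sound_claim_def by blast
    then show ?thesis using Prec xs 0 by simp
  next
    case (Suc k)
    then obtain w where "(recf_code (Prec f g), k # zs, w) \<in> set D" "(recf_code g, k # w # zs, v) \<in> set D"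
      using assms(1) Prec xs by (auto simp: justified_def Let_def)
    then have "eval (Prec f g) (k # zs) = Some w" "eval g (k # w # zs) = Some v"
      using sound unfolding sound_claim_def by blast+
    then show ?thesis using Prec xs Suc by simp
  qed
next
  case (Mu f)
  then have "(search_code f, 0 # xs, v) \<in> set D" using assms(1) by (simp add: justified_def Let_def)
  then have "sound_claim (search_code f) (0 # xs) v" by (rule sound)
  then have *: "eval f (v # xs) = Some 0" "\<forall>z<v. \<exists>w>0. eval f (z # xs) = Some w"
    unfolding sound_claim_def by auto
  then have "(LEAST y. eval f (y # xs) = Some 0) = v"
    by (rule Least_root)
  then show ?thesis unfolding Mu eval.simps minimize_def using * by auto
qed

lemma justified_sound:
  assumes "justified D (c, xs, v)"
    and sound: "\<And>c' xs' v'. (c', xs', v') \<in> set D \<Longrightarrow> sound_claim c' xs' v'"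
  shows "sound_claim c xs v"
  unfolding sound_claim_def
proof (intro conjI allI impI)
  fix r assume "c = recf_code r"
  then show "eval r xs = Some v" using justified_sound_recf assms by blast
next
  fix gs assume c: "c = args_code gs"
  show "map (\<lambda>g. eval g xs) gs = map Some (list_decode v)"
  proof (cases gs)
    case Nil
    then show ?thesis using assms(1) c by (simp add: justified_def Let_def)
  next
    case (Cons g hs)
    obtain ys where v: "v = list_encode ys" by (metis list_decode_inverse)
    then have "ys \<noteq> []" "(recf_code g, xs, hd ys) \<in> set D" "(args_code hs, xs, list_encode (tl ys)) \<in> set D"
      using assms(1) c Cons
      by (auto simp: justified_def Let_def list_encode_Cons_neq_0 simp del: list_encode.simps(2))
    then have "eval g xs = Some (hd ys)" "map (\<lambda>g. eval g xs) hs = map Some (list_decode (list_encode (tl ys)))"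
      using sound unfolding sound_claim_def by blast+
    then show ?thesis using Cons v \<open>ys \<noteq> []\<close> by (cases ys) simp_all
  qed
next
  fix f assume c: "c = search_code f"
  with assms(1) obtain y zs where xs: "xs = y # zs" by (cases xs) (auto simp: justified_def Let_def)
  then consider "(recf_code f, y # zs, 0) \<in> set D" "v = y"
    | w where "(recf_code f, y # zs, w) \<in> set D" "w > 0" "(search_code f, Suc y # zs, v) \<in> set D"
    using assms(1) c by (auto simp: justified_def Let_def)
  then have "eval f (v # zs) = Some 0 \<and> (\<forall>z. y \<le> z \<and> z < v \<longrightarrow> (\<exists>w>0. eval f (z # zs) = Some w))"
  proof cases
    case 1
    then show ?thesis using sound unfolding sound_claim_def by auto
  next
    case 2
    then have "eval f (y # zs) = Some w" "sound_claim (search_code f) (Suc y # zs) v"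
      using sound unfolding sound_claim_def by blast+
    with \<open>w > 0\<close> show ?thesis
      unfolding sound_claim_def by (auto simp: Suc_le_eq) (metis le_neq_implies_less)
  qed
  then show "eval f (v # tl xs) = Some 0" "\<And>z. hd xs \<le> z \<and> z < v \<Longrightarrow> \<exists>w>0. eval f (z # tl xs) = Some w"
    unfolding xs by auto
qed

lemma derivation_sound:
  "derivation D \<Longrightarrow> (c, xs, v) \<in> set D \<Longrightarrow> sound_claim c xs v"
proof (induction D arbitrary: c xs v)
  case (Cons z D)
  show ?case
  proof (cases "(c, xs, v) = z")
    case True
    then have "justified D (c, xs, v)" using Cons.prems(1) by (simp add: derivation_Cons)
    then show ?thesis
      by (rule justified_sound) (use Cons in \<open>simp add: derivation_Cons\<close>)
  next
    case False
    then show ?thesis using Cons by (simp add: derivation_Cons)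
  qed
qed simp

text \<open>
  The bound limits the code of a derivation rather than a number of steps; this is as good, for it is
  decidable, monotone in the bound, and exhausts the halting computations.
\<close>

definition halts_within :: "nat \<Rightarrow> nat \<Rightarrow> nat list \<Rightarrow> nat \<Rightarrow> bool" where
  "halts_within u c xs v \<longleftrightarrow> (\<exists>D. encode D < u \<and> derivation D \<and> (c, xs, v) \<in> set D)"

lemma halts_within_iff_eval: "(\<exists>u. halts_within u (recf_code r) xs v) \<longleftrightarrow> eval r xs = Some v"
proof
  assume "\<exists>u. halts_within u (recf_code r) xs v"
  then obtain D where "derivation D" "(recf_code r, xs, v) \<in> set D"
    unfolding halts_within_def by blast
  then show "eval r xs = Some v"
    using derivation_sound unfolding sound_claim_def by blast
next
  assume "eval r xs = Some v"
  then have "derivable (recf_code r) xs v" by (rule derivable_complete)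
  then show "\<exists>u. halts_within u (recf_code r) xs v"
    unfolding halts_within_def derivable_def by blast
qed

lemma halts_within_mono: "halts_within u c xs v \<Longrightarrow> u \<le> w \<Longrightarrow> halts_within w c xs v"
  unfolding halts_within_def by (meson less_le_trans)

text \<open>
  The search through derivations ranges over numbers, so each number has to be turned into a list of
  claims. Since the encoding of such lists is onto, its inverse is computed by the identity program.
\<close>

lemma surj_encode_nat: "surj (encode :: nat \<Rightarrow> nat)"
  by (rule surjI[of _ id]) simp

lemma surj_encode_prod:
  assumes "surj (encode :: 'a::encodable \<Rightarrow> nat)" "surj (encode :: 'b::encodable \<Rightarrow> nat)"
  shows "surj (encode :: 'a \<times> 'b \<Rightarrow> nat)"
proof (rule surjI)
  show "encode (inv (encode :: 'a \<Rightarrow> nat) (fst (prod_decode n)), inv (encode :: 'b \<Rightarrow> nat) (snd (prod_decode n))) = n" for n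
    using assms by (simp add: encode_prod_def surj_f_inv_f)
qed

lemma surj_encode_list:
  assumes "surj (encode :: 'a::encodable \<Rightarrow> nat)"
  shows "surj (encode :: 'a list \<Rightarrow> nat)"
proof (rule surjI)
  show "encode (map (inv (encode :: 'a \<Rightarrow> nat)) (list_decode n)) = n" for n
    using assms by (simp add: encode_list_def comp_def surj_f_inv_f)
qed

lemma surj_encode_claims: "surj (encode :: claim list \<Rightarrow> nat)"
  by (intro surj_encode_list surj_encode_prod surj_encode_nat)

lemma halts_within_alt:
  "halts_within u c xs v \<longleftrightarrow> (\<exists>k<u. derivation (inv encode k) \<and> (c, xs, v) \<in> set (inv encode k))"
proof
  assume "halts_within u c xs v"
  then obtain D where "encode D < u" "derivation D" "(c, xs, v) \<in> set D"
    unfolding halts_within_def by blast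
  moreover have "inv encode (encode D) = D" by (rule inv_f_f[OF inj_encode])
  ultimately show "\<exists>k<u. derivation (inv encode k) \<and> (c, xs, v) \<in> set (inv encode k)"
    by (intro exI[of _ "encode D"]) simp
next
  assume "\<exists>k<u. derivation (inv encode k) \<and> (c, xs, v) \<in> set (inv encode k)"
  then obtain k where k: "k < u" "derivation (inv encode k)" "(c, xs, v) \<in> set (inv encode k)"
    by blast
  moreover have "encode (inv encode k :: claim list) = k" by (rule surj_f_inv_f[OF surj_encode_claims])
  ultimately show "halts_within u c xs v"
    unfolding halts_within_def by (intro exI[of _ "inv encode k"]) simp
qed

lemma computable_inv_encode:
  assumes "surj (encode :: 'a::encodable \<Rightarrow> nat)" "computable f"
  shows "computable (\<lambda>x. inv (encode :: 'a \<Rightarrow> nat) (f x))"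
  using assms by (intro computable_recode[where g = "inv encode"]) (simp_all add: surj_f_inv_f)

lemma computable_halts_within [computable_intros]:
  assumes "computable u" "computable c" "computable xs" "computable v"
  shows "computable (\<lambda>x. halts_within (u x) (c x) (xs x) (v x))"
  unfolding halts_within_alt
  by (intro computable_intros assms assms[THEN computable_comp] computable_inv_encode surj_encode_claims)

section \<open>Interface to functions of several arguments\<close>

lemma total_computable_iff_computable: "total_computable f \<longleftrightarrow> computable f"
  unfolding total_computable_def partial_computable1_def computable_def by simp

lemma computable_pairing_imp_computable:
  assumes "computable_pairing p"
  shows "computable p"
proof -
  obtain r where r: "\<And>x y. eval r [x, y] = Some (p (x, y))"
    using assms unfolding computable_pairing_def partial_computable2_def by blast
  obtain q1 q2 where q1: "\<And>m. eval q1 [m] = Some (fst (prod_decode m))"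
    and q2: "\<And>m. eval q2 [m] = Some (snd (prod_decode m))"
    using recf_prod_decode by blast
  have "eval (Comp r [q1, q2]) [encode z] = Some (encode (p z))" for z
    by (cases z) (simp add: q1 q2 r encode_prod_def)
  then show ?thesis unfolding computable_def by blast
qed

text \<open>
  An arbitrary computable pairing is inverted by searching for the pair.
\<close>

lemma computable_inv_pairing:
  assumes "computable_pairing p" "computable f"
  shows "computable (\<lambda>x. inv p (f x))"
proof -
  have bij: "bij p" using assms(1) unfolding computable_pairing_def by blast
  have inv: "inv p v = prod_decode (LEAST y. p (prod_decode y) = v)" for v
  proof -
    have "p (prod_decode (prod_encode (inv p v))) = v"
      using bij by (simp add: bij_is_surj surj_f_inv_f)
    then have "p (prod_decode (LEAST y. p (prod_decode y) = v)) = v" by (rule LeastI)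
    then show ?thesis using bij by (metis bij_inv_eq_iff)
  qed
  have ex: "\<exists>y. p (prod_decode y) = v" for v
    using bij by (metis bij_pointE prod_encode_inverse)
  show ?thesis
    unfolding inv
    by (intro computable_prod_decode computable_Least computable_intros ex
        computable_comp[OF computable_pairing_imp_computable[OF assms(1)]] computable_comp[OF assms(2)])
qed

text \<open>
  Searching simultaneously for the value \<open>v\<close> and the bound \<open>u\<close> computes any function whose graph is the
  projection of a decidable relation.
\<close>

lemma partial_computable3_by_search:
  fixes E :: "nat \<Rightarrow> nat \<Rightarrow> nat \<Rightarrow> nat \<Rightarrow> nat \<Rightarrow> bool"
  assumes "computable (\<lambda>p. E (fst (fst p)) (fst (snd (fst p))) (snd (snd (fst p))) (fst (snd p)) (snd (snd p)))"
    and E: "\<And>i n x v. (\<exists>u. E i n x v u) \<longleftrightarrow> f i n x = Some v"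
  shows "partial_computable3 f"
proof -
  define P where "P z y = E (fst z) (fst (snd z)) (snd (snd z)) (fst (prod_decode y)) (snd (prod_decode y))" for z y
  have "computable (\<lambda>p. P (fst p) (snd p))"
    unfolding P_def
    using computable_comp[OF assms(1), of "\<lambda>p. (fst p, prod_decode (snd p))"]
    by (simp add: computable_intros)
  from recf_search[OF this] obtain r where
    r: "\<And>z. eval r [encode z] = (if \<exists>y. P z y then Some (LEAST y. P z y) else None)" by blast
  from computable_pairing_prod_encode obtain q where q: "\<And>x y. eval q [x, y] = Some (prod_encode (x, y))"
    unfolding computable_pairing_def partial_computable2_def by blast
  obtain q1 where q1: "\<And>m. eval q1 [m] = Some (fst (prod_decode m))"
    using recf_prod_decode by blast
  have "eval (Comp q1 [Comp r [Comp q [Proj 0, Comp q [Proj 1, Proj 2]]]]) [i, n, x] = f i n x" for i n x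
  proof -
    have 1: "eval (Comp q [Proj 0, Comp q [Proj 1, Proj 2]]) [i, n, x] = Some (encode (i, n, x))"
      by (simp add: q encode_prod_def)
    show ?thesis
    proof (cases "\<exists>y. P (i, n, x) y")
      case True
      then have "P (i, n, x) (LEAST y. P (i, n, x) y)" by (rule LeastI_ex)
      then have "\<exists>u. E i n x (fst (prod_decode (LEAST y. P (i, n, x) y))) u"
        unfolding P_def[of _ "Least _"] by auto
      then have "f i n x = Some (fst (prod_decode (LEAST y. P (i, n, x) y)))"
        unfolding E .
      with True show ?thesis
        unfolding eval.simps(4)[of q1] eval.simps(4)[of r] using 1 by (simp add: r q1 Let_def)
    next
      case False
      have "f i n x \<noteq> Some v" for v
      proof
        assume "f i n x = Some v"
        then obtain u where "E i n x v u" using E by blast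
        then have "P (i, n, x) (prod_encode (v, u))" by (simp add: P_def)
        with False show False by blast
      qed
      then have "f i n x = None" by (cases "f i n x") auto
      with False show ?thesis
        unfolding eval.simps(4)[of q1] eval.simps(4)[of r] using 1 by (simp add: r q1 Let_def)
    qed
  qed
  then show ?thesis unfolding partial_computable3_def by blast
qed

section \<open>Stages and redirections\<close>

definition owner :: "nat \<Rightarrow> nat" where "owner s = fst (prod_decode s)"
definition candidate :: "nat \<Rightarrow> nat" where "candidate s = fst (prod_decode (snd (prod_decode s)))"

lemma computable_owner [computable_intros]: "computable f \<Longrightarrow> computable (\<lambda>x. owner (f x))"
  unfolding owner_def by (intro computable_intros)

lemma computable_candidate [computable_intros]: "computable f \<Longrightarrow> computable (\<lambda>x. candidate (f x))"
  unfolding candidate_def by (intro computable_intros)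

text \<open>
  The bound \<open>v < s\<close> on the value is what makes the stage of a redirection exceed the stage that labels
  the index to which a reduction maps the witness. The argument \<open>2 * candidate s\<close> is the witness
  itself.
\<close>

definition due :: "nat \<Rightarrow> bool" where
  "due s \<longleftrightarrow> (\<exists>v<s. halts_within s (candidate s) [2 * candidate s] v)"

text \<open>
  Only the first stage at which a witness is due acts on it.
\<close>

definition redirects :: "nat \<Rightarrow> bool" where
  "redirects s \<longleftrightarrow> due s \<and> \<not> (\<exists>s'<s. owner s' = owner s \<and> candidate s' = candidate s \<and> due s')"

lemma computable_due [computable_intros]:
  assumes "computable f" shows "computable (\<lambda>x. due (f x))"
  unfolding due_def by (intro computable_intros assms computable_comp[OF assms])

lemma computable_redirects [computable_intros]:
  assumes "computable f" shows "computable (\<lambda>x. redirects (f x))"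
  unfolding redirects_def by (intro computable_intros assms computable_comp[OF assms])

lemma redirects_unique:
  assumes "redirects s" "redirects s'" "owner s = owner s'" "candidate s = candidate s'"
  shows "s = s'"
  using assms unfolding redirects_def by (metis linorder_neqE_nat)

lemma due_imp_redirects:
  assumes "due s"
  obtains s' where "redirects s'" "owner s' = owner s" "candidate s' = candidate s"
proof -
  define L where "L = (LEAST s'. owner s' = owner s \<and> candidate s' = candidate s \<and> due s')"
  have L: "owner L = owner s \<and> candidate L = candidate s \<and> due L"
    unfolding L_def by (rule LeastI[of _ s]) (simp add: assms)
  have "\<not> (owner s' = owner s \<and> candidate s' = candidate s \<and> due s')" if "s' < L" for s'
    using that unfolding L_def by (rule not_less_Least)
  with L have "redirects L" unfolding redirects_def by simp
  with L show thesis using that by blast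
qed

lemma ex_late_stage:
  obtains s where "owner s = i" "candidate s = e" "m \<le> s"
proof
  \<comment> \<open>The second component of the odd index is free, so it can push the stage beyond any bound.\<close>
  let ?s = "prod_encode (i, prod_encode (e, m))"
  show "owner ?s = i" "candidate ?s = e" by (simp_all add: owner_def candidate_def)
  show "m \<le> ?s" by (meson le_prod_encode_2 le_trans)
qed

section \<open>The construction of the numberings\<close>

locale dense_pair =
  fixes ra rb :: recf and \<alpha> \<beta> :: "nat \<Rightarrow> nat \<rightharpoonup> nat"
  assumes eval_ra: "eval ra [a, x] = \<alpha> a x"
    and eval_rb: "eval rb [b, x] = \<beta> b x"
    and inj_alpha: "inj \<alpha>"
    and inj_beta: "inj \<beta>"
    and disjoint: "range \<alpha> \<inter> range \<beta> = {}"
    and dense: "strongly_dense_in (range \<beta>) (range \<alpha>)"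
begin

lemma alpha_iff: "(\<exists>u. halts_within u (recf_code ra) [a, x] v) \<longleftrightarrow> \<alpha> a x = Some v"
  by (simp add: halts_within_iff_eval eval_ra)

lemma beta_iff: "(\<exists>u. halts_within u (recf_code rb) [b, x] v) \<longleftrightarrow> \<beta> b x = Some v"
  by (simp add: halts_within_iff_eval eval_rb)

text \<open>
  At bound \<open>t\<close> it is visible that \<open>\<beta> b\<close> extends the part of \<open>\<alpha> e\<close> visible at stage \<open>s\<close>.
\<close>

definition fits :: "nat \<Rightarrow> nat \<Rightarrow> nat \<Rightarrow> nat \<Rightarrow> bool" where
  "fits e s b t \<longleftrightarrow>
     (\<forall>x<s. \<forall>v<s. halts_within s (recf_code ra) [e, x] v \<longrightarrow> halts_within t (recf_code rb) [b, x] v)"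

lemma computable_fits [computable_intros]:
  assumes "computable e" "computable s" "computable b" "computable t"
  shows "computable (\<lambda>x. fits (e x) (s x) (b x) (t x))"
  unfolding fits_def
  by (intro computable_intros assms assms[THEN computable_comp])

text \<open>
  Strong density applied to the finite domain \<open>{..<s}\<close> gives infinitely many extensions; as they are finitely
  many values that have to be confirmed, one bound \<open>t\<close> serves for all of them.
\<close>

lemma ex_fits:
  assumes "finite F"
  shows "\<exists>b t. b \<notin> F \<and> fits e s b t"
proof -
  have "infinite {g \<in> range \<beta>. (\<alpha> e |` {..<s}) \<subseteq>\<^sub>m g}"
    using dense unfolding strongly_dense_in_def by blast
  then have "\<not> {g \<in> range \<beta>. (\<alpha> e |` {..<s}) \<subseteq>\<^sub>m g} \<subseteq> \<beta> ` F"
    using assms finite_surj by blast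
  then obtain b where "b \<notin> F" and ext: "(\<alpha> e |` {..<s}) \<subseteq>\<^sub>m \<beta> b" by blast
  have "\<exists>u. halts_within s (recf_code ra) [e, x] v \<longrightarrow> halts_within u (recf_code rb) [b, x] v" if "x < s" for x v
  proof (cases "halts_within s (recf_code ra) [e, x] v")
    case True
    then have "\<alpha> e x = Some v" using alpha_iff by blast
    then have "\<beta> b x = Some v" using ext that unfolding map_le_def by (force simp: dom_def restrict_map_def)
    then show ?thesis using beta_iff by blast
  qed simp
  then obtain U where U: "\<And>x v. x < s \<Longrightarrow> halts_within s (recf_code ra) [e, x] v \<Longrightarrow> halts_within (U x v) (recf_code rb) [b, x] v"
    by metis
  \<comment> \<open>Only values below \<open>s\<close> count in \<open>fits\<close>, so this is a maximum over a finite set.\<close>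
  let ?t = "Max ((\<lambda>(x, v). U x v) ` ({..<s} \<times> {..<s}))"
  have "U x v \<le> ?t" if "x < s" "v < s" for x v
    using that by (intro Max_ge) auto
  then have "fits e s b ?t"
    unfolding fits_def by (intro allI impI) (rule halts_within_mono[OF U])
  with \<open>b \<notin> F\<close> have "\<exists>t. b \<notin> F \<and> fits e s b t" by (intro exI conjI)
  then show ?thesis by blast
qed

text \<open>
  The list \<open>h\<close> holds the earlier stages with their targets. A redirection avoids all earlier targets,
  because witnesses of different numberings must be kept apart; any other stage avoids only those in
  its own numbering, because that numbering has to reach every index of \<open>\<beta>\<close>.
\<close>

definition choose_target :: "nat \<Rightarrow> (nat \<times> nat) list \<Rightarrow> nat" where
  "choose_target s h =
     (if redirects s
      then fst (prod_decode (LEAST y. fits (candidate s) s (fst (prod_decode y)) (snd (prod_decode y)) \<and>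
             \<not> (\<exists>d\<in>set h. snd d = fst (prod_decode y))))
      else (LEAST b. \<not> (\<exists>d\<in>set h. owner (fst d) = owner s \<and> snd d = b)))"

lemma ex_redirect_target:
  "\<exists>y. fits e s (fst (prod_decode y)) (snd (prod_decode y)) \<and> \<not> (\<exists>d\<in>set h. snd d = fst (prod_decode y))"
proof -
  obtain b t where "b \<notin> snd ` set h" "fits e s b t" using ex_fits[of "snd ` set h" e s] by blast
  then show ?thesis by (intro exI[of _ "prod_encode (b, t)"]) auto
qed

lemma ex_unused: "\<exists>b. \<not> (\<exists>d\<in>set h. P d \<and> snd d = (b :: nat))"
proof -
  obtain b where "b \<notin> snd ` set h" using ex_new_if_finite[of "snd ` set h"] by auto
  then have "\<not> (\<exists>d\<in>set h. P d \<and> snd d = b)" by blast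
  then show ?thesis by blast
qed

lemma computable_choose_target [computable_intros]:
  assumes "computable s" "computable h"
  shows "computable (\<lambda>x. choose_target (s x) (h x))"
  unfolding choose_target_def
  by (intro computable_If computable_Least computable_fst computable_prod_decode ex_redirect_target ex_unused;
      intro computable_intros assms assms[THEN computable_comp])

definition history :: "nat \<Rightarrow> (nat \<times> nat) list" where
  "history s = rec_nat [] (\<lambda>k h. (k, choose_target k h) # h) s"

definition target :: "nat \<Rightarrow> nat" where
  "target s = choose_target s (history s)"

lemma set_history: "set (history s) = {(s', target s') | s'. s' < s}"
  by (induction s) (auto simp: history_def target_def less_Suc_eq)

lemma computable_target [computable_intros]:
  assumes "computable s" shows "computable (\<lambda>x. target (s x))"
  unfolding target_def history_def by (intro computable_intros assms)

lemma target_redirect: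
  assumes "redirects s"
  shows "\<exists>t. fits (candidate s) s (target s) t" "s' < s \<Longrightarrow> target s' \<noteq> target s"
proof -
  let ?P = "\<lambda>y. fits (candidate s) s (fst (prod_decode y)) (snd (prod_decode y)) \<and>
             \<not> (\<exists>d\<in>set (history s). snd d = fst (prod_decode y))"
  have "?P (LEAST y. ?P y)" by (rule LeastI_ex[OF ex_redirect_target])
  moreover have v: "target s = fst (prod_decode (LEAST y. ?P y))"
    using assms by (simp add: target_def choose_target_def)
  ultimately show "\<exists>t. fits (candidate s) s (target s) t" "s' < s \<Longrightarrow> target s' \<noteq> target s"
    unfolding v[symmetric] set_history by auto
qed

lemma target_plain:
  assumes "\<not> redirects s"
  shows "s' < s \<Longrightarrow> owner s' = owner s \<Longrightarrow> target s' \<noteq> target s"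
    and "b < target s \<Longrightarrow> \<exists>s'<s. owner s' = owner s \<and> target s' = b"
proof -
  let ?P = "\<lambda>b. \<not> (\<exists>d\<in>set (history s). owner (fst d) = owner s \<and> snd d = b)"
  have "?P (LEAST y. ?P y)" by (rule LeastI_ex[OF ex_unused])
  moreover have v: "target s = (LEAST b. ?P b)"
    using assms by (simp add: target_def choose_target_def)
  ultimately show "s' < s \<Longrightarrow> owner s' = owner s \<Longrightarrow> target s' \<noteq> target s"
    unfolding v[symmetric] set_history by auto
  show "\<exists>s'<s. owner s' = owner s \<and> target s' = b" if "b < target s"
  proof -
    have "b < (LEAST b. ?P b)" using that unfolding v .
    from not_less_Least[OF this] show ?thesis unfolding set_history by auto
  qed
qed

lemma target_fresh: "s' < s \<Longrightarrow> owner s' = owner s \<Longrightarrow> target s' \<noteq> target s"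
  using target_redirect(2) target_plain(1) by blast

lemma target_inj: "owner s' = owner s \<Longrightarrow> target s' = target s \<Longrightarrow> s' = s"
  using target_fresh by (metis linorder_neqE_nat)

text \<open>
  Witness \<open>0\<close> alone gives infinitely many stages of \<open>i\<close>, of which at most one is a redirection. If
  \<open>b\<close> were never a target, the others would all have targets below \<open>b\<close>, as they take the least unused
  number, contradicting injectivity.
\<close>

lemma target_surj: "\<exists>s. owner s = i \<and> target s = b"
proof (rule ccontr)
  assume *: "\<nexists>s. owner s = i \<and> target s = b"
  let ?S = "{s. owner s = i \<and> candidate s = 0}"
  have "infinite ?S"
  proof (rule notI)
    assume "finite ?S"
    then obtain m where "\<forall>s\<in>?S. s < m" unfolding finite_nat_set_iff_bounded by blast
    moreover obtain s where "owner s = i" "candidate s = 0" "m \<le> s" by (rule ex_late_stage)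
    ultimately show False by auto
  qed
  moreover have "finite {s \<in> ?S. redirects s}"
  proof (cases "\<exists>t. t \<in> ?S \<and> redirects t")
    case True
    then obtain t where "t \<in> ?S" "redirects t" by blast
    then have "{s \<in> ?S. redirects s} \<subseteq> {t}" using redirects_unique by auto
    then show ?thesis by (rule finite_subset) simp
  next
    case False
    then have "{s \<in> ?S. redirects s} = {}" by blast
    then show ?thesis by (simp only: finite.emptyI)
  qed
  ultimately have inf: "infinite (?S - {s \<in> ?S. redirects s})" by (rule Diff_infinite_finite[rotated])
  have "target ` (?S - {s \<in> ?S. redirects s}) \<subseteq> {..b}"
  proof (rule image_subsetI)
    fix s assume "s \<in> ?S - {s \<in> ?S. redirects s}"
    then have "owner s = i" "\<not> redirects s" by auto
    then have "\<not> b < target s" using target_plain(2)[of s b] * by blast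
    then show "target s \<in> {..b}" by simp
  qed
  then have "finite (target ` (?S - {s \<in> ?S. redirects s}))" by (rule finite_subset) simp
  moreover have "inj_on target (?S - {s \<in> ?S. redirects s})"
  proof (rule inj_onI)
    fix s t assume "s \<in> ?S - {s \<in> ?S. redirects s}" "t \<in> ?S - {s \<in> ?S. redirects s}" "target s = target t"
    then show "s = t" by - (rule target_inj, auto)
  qed
  ultimately show False using inf finite_imageD by blast
qed

text \<open>
  The final state of the construction. Whether an even index is ever redirected is not decidable; the
  numbering itself is approximated through \<open>emits\<close> below.
\<close>

definition label :: "nat \<Rightarrow> nat \<Rightarrow> nat + nat" where
  "label i n =
     (if even n
      then if \<exists>s. redirects s \<and> owner s = i \<and> candidate s = n div 2
           then Inr (target (THE s. redirects s \<and> owner s = i \<and> candidate s = n div 2))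
           else Inl (n div 2)
      else if redirects (prod_encode (i, n div 2)) then Inl (candidate (prod_encode (i, n div 2)))
           else Inr (target (prod_encode (i, n div 2))))"

lemma label_even_redirected: "redirects s \<Longrightarrow> label (owner s) (2 * candidate s) = Inr (target s)"
proof -
  assume s: "redirects s"
  then have "(THE s'. redirects s' \<and> owner s' = owner s \<and> candidate s' = candidate s) = s"
    by (intro the_equality) (auto intro: redirects_unique)
  with s show ?thesis by (auto simp: label_def)
qed

lemma label_even_kept:
  "\<nexists>s. redirects s \<and> owner s = i \<and> candidate s = e \<Longrightarrow> label i (2 * e) = Inl e"
  by (simp add: label_def)

lemma label_odd:
  assumes "prod_decode s = (i, m)"
  shows "label i (Suc (2 * m)) = (if redirects s then Inl (candidate s) else Inr (target s))"
proof -
  have "s = prod_encode (i, m)" using assms by (metis prod_decode_inverse)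
  then show ?thesis by (simp add: label_def)
qed

lemma label_eq_Inl:
  assumes "label i n = Inl e"
  obtains "n = 2 * e" "\<nexists>s. redirects s \<and> owner s = i \<and> candidate s = e"
  | s where "redirects s" "candidate s = e" "prod_decode s = (i, n div 2)" "odd n"
  using assms by (cases "even n") (auto simp: label_def split: if_splits)

lemma label_eq_Inr:
  assumes "label i n = Inr b"
  obtains s where "redirects s" "target s = b" "owner s = i" "n = 2 * candidate s"
  | s where "\<not> redirects s" "target s = b" "prod_decode s = (i, n div 2)" "odd n"
proof (cases "even n")
  case True
  then obtain m where n: "n = 2 * m" by (elim evenE)
  with assms obtain s where s: "redirects s" "owner s = i" "candidate s = m"
    by (auto simp: label_def split: if_splits)
  then have "target s = b" using label_even_redirected[of s] assms n by simp
  with s n show thesis by - (rule that(1), auto)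
next
  case False
  then show thesis using assms that(2) by (auto simp: label_def split: if_splits)
qed

lemma owner_prod_decode: "prod_decode s = (i, m) \<Longrightarrow> owner s = i"
  by (simp add: owner_def)

lemma prod_decode_inj: "prod_decode s = p \<Longrightarrow> prod_decode s' = p \<Longrightarrow> s = s'"
  by (metis prod_decode_inverse)

lemma odd_eqI: "odd m \<Longrightarrow> odd n \<Longrightarrow> m div 2 = n div 2 \<Longrightarrow> m = (n :: nat)"
  by presburger

section \<open>The numberings are Friedberg numberings\<close>

lemma inj_label: "inj (label i)"
proof (rule injI)
  fix m n assume eq: "label i m = label i n"
  show "m = n"
  proof (cases "label i m")
    case (Inl e)
    with eq have "label i n = Inl e" by simp
    from Inl show ?thesis
    proof (cases rule: label_eq_Inl)
      case 1
      from \<open>label i n = Inl e\<close> show ?thesis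
        by (cases rule: label_eq_Inl) (use 1 owner_prod_decode in auto)
    next
      case (2 s)
      from \<open>label i n = Inl e\<close> show ?thesis
      proof (cases rule: label_eq_Inl)
        case 1
        with 2 owner_prod_decode show ?thesis by blast
      next
        case (2 s')
        then have "s = s'"
          using \<open>redirects s\<close> \<open>candidate s = e\<close> \<open>prod_decode s = (i, m div 2)\<close>
          by (metis redirects_unique owner_prod_decode)
        with 2 \<open>odd m\<close> \<open>prod_decode s = (i, m div 2)\<close> show ?thesis by (auto intro: odd_eqI)
      qed
    qed
  next
    case (Inr b)
    with eq have "label i n = Inr b" by simp
    from Inr show ?thesis
    proof (cases rule: label_eq_Inr)
      case (1 s)
      from \<open>label i n = Inr b\<close> show ?thesis
      proof (cases rule: label_eq_Inr)
        case (1 s')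
        then have "s = s'" using \<open>target s = b\<close> \<open>owner s = i\<close> target_inj by metis
        then show ?thesis using 1 \<open>m = 2 * candidate s\<close> by simp
      next
        case (2 s')
        then have "s = s'" using 1 target_inj owner_prod_decode by metis
        then show ?thesis using 1 2 by blast
      qed
    next
      case (2 s)
      from \<open>label i n = Inr b\<close> show ?thesis
      proof (cases rule: label_eq_Inr)
        case (1 s')
        then have "s = s'" using 2 target_inj owner_prod_decode by metis
        then show ?thesis using 1 2 by blast
      next
        case (2 s')
        then have "s = s'"
          using \<open>target s = b\<close> \<open>prod_decode s = (i, m div 2)\<close> by (metis target_inj owner_prod_decode)
        with 2 \<open>odd m\<close> \<open>prod_decode s = (i, m div 2)\<close> show ?thesis by (auto intro: odd_eqI)
      qed
    qed
  qed
qed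

text \<open>
  An index \<open>e\<close> of \<open>\<alpha>\<close> that has lost its witness reappears at the odd index of the redirecting stage.
\<close>

lemma surj_label: "surj (label i)"
proof (rule surjI)
  fix l
  show "label i (SOME n. label i n = l) = l"
  proof (rule someI_ex, cases l)
    case (Inl e)
    show "\<exists>n. label i n = l"
    proof (cases "\<exists>s. redirects s \<and> owner s = i \<and> candidate s = e")
      case True
      then obtain s where s: "redirects s" "owner s = i" "candidate s = e" by blast
      then have "prod_decode s = (i, snd (prod_decode s))" by (simp add: owner_def prod_eq_iff)
      from label_odd[OF this] s Inl show ?thesis by auto
    next
      case False
      with Inl label_even_kept show ?thesis by blast
    qed
  next
    case (Inr b)
    obtain s where s: "owner s = i" "target s = b" using target_surj by blast
    show "\<exists>n. label i n = l"
    proof (cases "redirects s")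
      case True
      with s Inr label_even_redirected show ?thesis by blast
    next
      case False
      from s have "prod_decode s = (i, snd (prod_decode s))" by (simp add: owner_def prod_eq_iff)
      from label_odd[OF this] s Inr False show ?thesis by auto
    qed
  qed
qed

definition \<nu> :: "nat \<Rightarrow> nat \<Rightarrow> nat \<rightharpoonup> nat" where
  "\<nu> i n = case_sum \<alpha> \<beta> (label i n)"

lemma inj_case_sum: "inj (case_sum \<alpha> \<beta>)"
proof (rule injI)
  have ne: "\<alpha> a \<noteq> \<beta> b" for a b using disjoint by (metis disjoint_iff rangeI)
  then have ne': "\<beta> b \<noteq> \<alpha> a" for a b by metis
  fix k l assume "case_sum \<alpha> \<beta> k = case_sum \<alpha> \<beta> l"
  then show "k = l"
    using ne ne' injD[OF inj_alpha] injD[OF inj_beta] by (cases k; cases l) auto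
qed

lemma nu_eq_iff: "\<nu> i m = \<nu> j n \<longleftrightarrow> label i m = label j n"
  unfolding \<nu>_def using inj_case_sum by (simp add: inj_eq)

lemma inj_nu: "inj (\<nu> i)"
  by (rule injI) (simp add: nu_eq_iff inj_eq[OF inj_label])

lemma range_nu: "range (\<nu> i) = range \<alpha> \<union> range \<beta>"
proof -
  have "range (\<nu> i) = case_sum \<alpha> \<beta> ` range (label i)" by (auto simp: \<nu>_def)
  also have "\<dots> = range \<alpha> \<union> range \<beta>"
    unfolding surj_label UNIV_sum by (auto simp: image_Un image_image)
  finally show ?thesis .
qed

text \<open>
  Value \<open>v\<close> is emitted at time \<open>u\<close> if it is visible in the function that the index follows at that
  time. In the second disjunct the bounds on \<open>x\<close> and \<open>v\<close> ensure that everything emitted before a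
  redirection is covered by the extension requirement \<open>fits\<close> of that redirection.
\<close>

definition emits :: "nat \<Rightarrow> nat \<Rightarrow> nat \<Rightarrow> nat \<Rightarrow> nat \<Rightarrow> bool" where
  "emits i n x v u =
     (if n = 2 * (n div 2)
      then (\<exists>s<u. redirects s \<and> owner s = i \<and> candidate s = n div 2 \<and> halts_within u (recf_code rb) [target s, x] v) \<or>
           (\<not> (\<exists>s<u. redirects s \<and> owner s = i \<and> candidate s = n div 2) \<and>
            x < u \<and> v < u \<and> halts_within u (recf_code ra) [n div 2, x] v)
      else if redirects (prod_encode (i, n div 2))
           then halts_within u (recf_code ra) [candidate (prod_encode (i, n div 2)), x] v
           else halts_within u (recf_code rb) [target (prod_encode (i, n div 2)), x] v)"

lemma computable_emits:
  "computable (\<lambda>p. emits (fst (fst p)) (fst (snd (fst p))) (snd (snd (fst p))) (fst (snd p)) (snd (snd p)))"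
  unfolding emits_def by (intro computable_intros)

text \<open>
  Values emitted before a redirection remain correct afterwards because the target extends them, and every
  value of the final function is emitted eventually.
\<close>

lemma emits_iff: "(\<exists>u. emits i n x v u) \<longleftrightarrow> \<nu> i n x = Some v"
proof (cases "even n")
  case False
  then have "n \<noteq> 2 * (n div 2)" by presburger
  with False show ?thesis
    unfolding emits_def \<nu>_def label_def using alpha_iff beta_iff by simp
next
  case True
  then obtain e where n: "n = 2 * e" by (elim evenE)
  show ?thesis
  proof (cases "\<exists>s. redirects s \<and> owner s = i \<and> candidate s = e")
    case False
    then have "\<nu> i n = \<alpha> e" unfolding n \<nu>_def by (simp add: label_even_kept)
    moreover have "(\<exists>u. emits i n x v u) \<longleftrightarrow> (\<exists>u. x < u \<and> v < u \<and> halts_within u (recf_code ra) [e, x] v)"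
      unfolding n emits_def using False by auto
    moreover have "\<dots> \<longleftrightarrow> (\<exists>u. halts_within u (recf_code ra) [e, x] v)"
    proof
      assume "\<exists>u. halts_within u (recf_code ra) [e, x] v"
      then obtain u where "halts_within u (recf_code ra) [e, x] v" by blast
      then have "halts_within (Suc (u + x + v)) (recf_code ra) [e, x] v" by (rule halts_within_mono) simp
      then show "\<exists>u. x < u \<and> v < u \<and> halts_within u (recf_code ra) [e, x] v"
        by (intro exI[of _ "Suc (u + x + v)"]) simp
    qed blast
    ultimately show ?thesis using alpha_iff by simp
  next
    case True
    then obtain s where s: "redirects s" "owner s = i" "candidate s = e" by blast
    then have nu: "\<nu> i n = \<beta> (target s)" unfolding n \<nu>_def using label_even_redirected[of s] by simp
    have uniq: "redirects s' \<and> owner s' = i \<and> candidate s' = e \<longleftrightarrow> s' = s" for s'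
      using s redirects_unique by blast
    have emits: "emits i n x v u \<longleftrightarrow>
        (if s < u then halts_within u (recf_code rb) [target s, x] v
         else x < u \<and> v < u \<and> halts_within u (recf_code ra) [e, x] v)" for u
    proof -
      have "(\<exists>s'<u. redirects s' \<and> owner s' = i \<and> candidate s' = e \<and> Q s') \<longleftrightarrow> s < u \<and> Q s" for Q
      proof
        assume "\<exists>s'<u. redirects s' \<and> owner s' = i \<and> candidate s' = e \<and> Q s'"
        then obtain s' where s': "s' < u" "redirects s' \<and> owner s' = i \<and> candidate s' = e" "Q s'" by blast
        with uniq have "s' = s" by blast
        with s' show "s < u \<and> Q s" by simp
      next
        assume "s < u \<and> Q s"
        with s show "\<exists>s'<u. redirects s' \<and> owner s' = i \<and> candidate s' = e \<and> Q s'"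
          by (intro exI[of _ s]) simp
      qed
      from this[of "\<lambda>_. True"] this[of "\<lambda>s. halts_within u (recf_code rb) [target s, x] v"]
      show ?thesis unfolding n emits_def by simp
    qed
    show ?thesis unfolding nu
    proof
      assume "\<exists>u. emits i n x v u"
      then obtain u where u: "emits i n x v u" by blast
      show "\<beta> (target s) x = Some v"
      proof (cases "s < u")
        case True
        with u emits have "halts_within u (recf_code rb) [target s, x] v" by simp
        then show ?thesis using beta_iff by blast
      next
        \<comment> \<open>The value was emitted at a time \<open>u \<le> s\<close>, before the redirection at \<open>s\<close>.\<close>
        case False
        with u emits have "x < s" "v < s" "halts_within s (recf_code ra) [e, x] v"
          by (auto intro: halts_within_mono)
        with target_redirect(1)[OF s(1)] s(3) beta_iff show ?thesis unfolding fits_def by blast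
      qed
    next
      assume "\<beta> (target s) x = Some v"
      then obtain u where "halts_within u (recf_code rb) [target s, x] v" using beta_iff by blast
      then have "halts_within (Suc (u + s)) (recf_code rb) [target s, x] v" by (rule halts_within_mono) simp
      then show "\<exists>u. emits i n x v u" unfolding emits by (intro exI[of _ "Suc (u + s)"]) simp
    qed
  qed
qed

lemma uniformly_ce_nu: "uniformly_ce \<nu>"
  unfolding uniformly_ce_def by (rule partial_computable3_by_search[OF computable_emits emits_iff])

lemma partial_computable2_nu: "partial_computable2 (\<nu> i)"
proof -
  obtain r where r: "\<And>i n x. eval r [i, n, x] = \<nu> i n x"
    using uniformly_ce_nu unfolding uniformly_ce_def partial_computable3_def by blast
  obtain k where k: "\<And>xs. eval k xs = Some i" using recf_const by blast
  have "eval (Comp r [k, Proj 0, Proj 1]) [n, x] = \<nu> i n x" for n x by (simp add: k r)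
  then show ?thesis unfolding partial_computable2_def by blast
qed

section \<open>Independence\<close>

text \<open>
  The diagonal argument, with a reduction represented by the stage number \<open>\<langle>j, k div 2\<rangle>\<close> of its value. Only
  this number is used of the reduction: the witness is redirected after that stage, and so to a label
  that the stage did not assign.
\<close>

lemma label_not_reducible:
  assumes "computable (g :: nat \<Rightarrow> nat)"
  shows "\<exists>n. \<forall>j k. j \<noteq> i \<longrightarrow> g n = prod_encode (j, k div 2) \<longrightarrow> label i n \<noteq> label j k"
proof -
  obtain r where r: "\<And>n. eval r [n] = Some (g n)"
    using assms unfolding computable_def by auto
  define e where "e = recf_code r"
  obtain u where u: "halts_within u e [2 * e] (g (2 * e))"
    using r halts_within_iff_eval unfolding e_def by blast
  \<comment> \<open>A stage late enough to see the computation halt; the witness acts there or has acted before.\<close>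
  obtain s' where s': "owner s' = i" "candidate s' = e" "Suc (u + g (2 * e)) \<le> s'" by (rule ex_late_stage)
  then have "halts_within s' e [2 * e] (g (2 * e))" using u by (elim halts_within_mono) simp
  then have "due s'" unfolding due_def using s' by (intro exI[of _ "g (2 * e)"]) simp
  then obtain s where s: "redirects s" "owner s = i" "candidate s = e"
    using due_imp_redirects s' by metis
  then obtain v where "v < s" "halts_within s e [2 * e] v" unfolding redirects_def due_def by blast
  then have "eval r [2 * e] = Some v" using halts_within_iff_eval unfolding e_def by blast
  with r \<open>v < s\<close> have g: "g (2 * e) < s" by simp
  have l: "label i (2 * e) = Inr (target s)" using label_even_redirected s by blast
  have "label i (2 * e) \<noteq> label j k" if "j \<noteq> i" "g (2 * e) = prod_encode (j, k div 2)" for j k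
  proof
    assume "label i (2 * e) = label j k"
    with l have "label j k = Inr (target s)" by simp
    then show False
    proof (cases rule: label_eq_Inr)
      case (1 s'')
      with s \<open>j \<noteq> i\<close> have "s'' \<noteq> s" by blast
      then consider "s'' < s" | "s < s''" by linarith
      then show False
        using target_redirect(2)[OF s(1), of s''] target_redirect(2)[OF 1(1), of s] 1(2) by cases auto
    next
      case (2 s'')
      then have "s'' = g (2 * e)" using that(2) prod_decode_inverse[of s''] by simp
      with g have "s'' < s" by simp
      with target_redirect(2)[OF s(1)] 2(2) show False by blast
    qed
  qed
  then show ?thesis by (intro exI[of _ "2 * e"] allI impI)
qed

lemma independent_nu:
  assumes "computable_pairing pair"
  shows "independent_sequence pair \<nu>"
  unfolding independent_sequence_def
proof (intro allI notI)
  fix i assume "reducible (\<nu> i) (direct_sum pair (omit i \<nu>))"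
  then obtain f where f: "computable f" and eq: "\<nu> i = direct_sum pair (omit i \<nu>) \<circ> f"
    unfolding reducible_def total_computable_iff_computable by blast
  \<comment> \<open>Undo the reindexing of \<open>omit\<close>; by construction \<open>j n\<close> is never \<open>i\<close>.\<close>
  define j where "j n = (if fst (inv pair (f n)) < i then fst (inv pair (f n)) else Suc (fst (inv pair (f n))))" for n
  define k where "k n = snd (inv pair (f n))" for n
  have "computable (\<lambda>n. prod_encode (j n, k n div 2))"
    unfolding j_def k_def
    by (intro computable_intros computable_inv_pairing[OF assms] f)
  from label_not_reducible[OF this, of i] obtain n where
    n: "\<forall>j' k'. j' \<noteq> i \<longrightarrow> prod_encode (j n, k n div 2) = prod_encode (j', k' div 2) \<longrightarrow>
      label i n \<noteq> label j' k'" ..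
  have "j n \<noteq> i" by (simp add: j_def)
  have "\<nu> i n = \<nu> (j n) (k n)"
    using fun_cong[OF eq, of n]
    by (cases "inv pair (f n)") (simp add: direct_sum_def omit_def j_def k_def)
  then have "label i n = label (j n) (k n)" by (simp only: nu_eq_iff)
  moreover have "label i n \<noteq> label (j n) (k n)"
    using n[rule_format, OF \<open>j n \<noteq> i\<close> refl] .
  ultimately show False by contradiction
qed

end

theorem corollary11:
  fixes A B :: "(nat \<rightharpoonup> nat) set"
    and pair :: "nat \<times> nat \<Rightarrow> nat"
  assumes "computable_pairing pair"
    and "A \<subseteq> partial_computable_functions"
    and "B \<subseteq> partial_computable_functions"
    and "A \<inter> B = {}"
    and "\<exists>\<alpha>. friedberg_numbering \<alpha> A"
    and "\<exists>\<beta>. friedberg_numbering \<beta> B"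
    and "strongly_dense_in B A"
  shows "\<exists>\<nu>. uniformly_ce \<nu> \<and> (\<forall>i. friedberg_numbering (\<nu> i) (A \<union> B)) \<and>
    independent_sequence pair \<nu>"
proof -
  obtain \<alpha> \<beta> where \<alpha>: "friedberg_numbering \<alpha> A" and \<beta>: "friedberg_numbering \<beta> B"
    using assms(5,6) by blast
  have A: "range \<alpha> = A" "inj \<alpha>" and B: "range \<beta> = B" "inj \<beta>"
    using \<alpha> \<beta> unfolding friedberg_numbering_def computable_numbering_def numbering_def by blast+
  obtain ra where ra: "\<And>a x. eval ra [a, x] = \<alpha> a x"
    using \<alpha> unfolding friedberg_numbering_def computable_numbering_def partial_computable2_def by blast
  obtain rb where rb: "\<And>b x. eval rb [b, x] = \<beta> b x"
    using \<beta> unfolding friedberg_numbering_def computable_numbering_def partial_computable2_def by blast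
  interpret dense_pair ra rb \<alpha> \<beta>
  proof
    show "eval ra [a, x] = \<alpha> a x" "eval rb [b, x] = \<beta> b x" for a b x by (rule ra, rule rb)
    show "inj \<alpha>" "inj \<beta>" by fact+
    show "range \<alpha> \<inter> range \<beta> = {}" "strongly_dense_in (range \<beta>) (range \<alpha>)"
      unfolding A(1) B(1) by fact+
  qed
  have "friedberg_numbering (\<nu> i) (A \<union> B)" for i
    unfolding friedberg_numbering_def computable_numbering_def numbering_def
    using range_nu[of i] inj_nu partial_computable2_nu A(1) B(1) by simp
  then have "uniformly_ce \<nu> \<and> (\<forall>i. friedberg_numbering (\<nu> i) (A \<union> B)) \<and>
      independent_sequence pair \<nu>"
    using uniformly_ce_nu independent_nu[OF assms(1)] by simp
  then show ?thesis by - (rule exI[of _ \<nu>])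
qed

end
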